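(* For every integer $k\ge 0$, any quasi-smooth odd dimensional member $X_{14}^{2k+1}\subset\mathbb{P}(2,3,4,5,7^{2k+1})$ (a quasi-smooth hypersurface of degree $14$) is of Anti-Torelli type, while any quasi-smooth even dimensional member $X_{14}^{2k}\subset\mathbb{P}(2,3,4,5,7^{2k})$ (a quasi-smooth hypersurface of degree $14$) is of Torelli type. In particular there is an infinite chain of varieties of Gushel–Mukai type, in which each $X_{14}^{j}$ is a double cover of $\mathbb{P}(2,3,4,5,7^{j-1})$ branched over $X_{14}^{j-1}$, which are alternately, according to the parity of the dimension, examples and counterexamples for the infinitesimal Torelli problem.
   Context: All varieties are over $\mathbb{C}$. $\mathbb{P}(2,3,4,5,7^{j})$ is the weighted projective space with weights $2,3,4,5$ and $7$ repeated $j$ times; a degree $14$ hypersurface $X=X_{14}^j=V(f)$ in it has dimension $m=j+2$. It is quasi-smooth if its affine cone $\{f=0\}$ is smooth outside the origin. The Jacobian ring $R$ is the polynomial ring in the weighted coordinates modulo the partial derivatives of $f$, with graded pieces $R_k$. Put $d=14$ and let $s=14+7j$ be the sum of the weights. By the Griffiths–Steenbrink description, $H^{m-q,q}_{\mathrm{prim}}(X)\cong R_{(q+1)d-s}$, the infinitesimal deformations of $X$ as a hypersurface are $H^1(T_X)_{\mathrm{proj}}\cong R_d$ (equal to $H^1(T_X)$ when $m\ge 3$), and the differential of the period map is the map induced by multiplication $$R_d\longrightarrow\bigoplus_{q}\mathrm{Hom}\bigl(R_{(q+1)d-s},R_{(q+2)d-s}\bigr).$$ $X$ is of Torelli type if this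 map is injective (infinitesimal Torelli holds) and of Anti-Torelli type if it is not injective. "Gushel–Mukai type" here means members of a tower of double covers as follows: starting from $X_{14}^0=V(f_0)\subset\mathbb{P}(2,3,4,5)$, set $X_{14}^j=V(f_0+y_1^2+\cdots+y_j^2)\subset\mathbb{P}(2,3,4,5,7^j)$ with each $y_i$ of weight $7$. *)

theory Defs
  imports Complex_Main "HOL-Library.Poly_Mapping" "HOL-Library.FuncSet" "HOL-Algebra.QuotRing"
begin

section \<open>Weighted polynomial rings\<close>

text \<open>
  A monomial is a finitely supported exponent vector, a polynomial a finitely supported family of
  complex coefficients. The variables are numbered from 0; the polynomial ring in \<open>n\<close> variables
  consists of the polynomials that involve only variables with index below \<open>n\<close>. This allows \<open>n\<close> to
  vary inside a statement.
\<close>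

type_synonym mono = "nat \<Rightarrow>\<^sub>0 nat"
type_synonym cpoly = "mono \<Rightarrow>\<^sub>0 complex"

definition var :: "nat \<Rightarrow> cpoly" where
  "var i = Poly_Mapping.single (Poly_Mapping.single i 1) 1"

definition polys :: "nat \<Rightarrow> cpoly set" where
  "polys n = {p. \<forall>m\<in>Poly_Mapping.keys p. Poly_Mapping.keys m \<subseteq> {..<n}}"

definition weighted_deg :: "(nat \<Rightarrow> nat) \<Rightarrow> mono \<Rightarrow> nat" where
  "weighted_deg w m = (\<Sum>i\<in>Poly_Mapping.keys m. w i * Poly_Mapping.lookup m i)"

text \<open>Degrees are integers; in negative degree only the zero polynomial remains.\<close>

definition homogeneous_polys :: "nat \<Rightarrow> (nat \<Rightarrow> nat) \<Rightarrow> int \<Rightarrow> cpoly set" where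
  "homogeneous_polys n w k =
     {p \<in> polys n. \<forall>m\<in>Poly_Mapping.keys p. int (weighted_deg w m) = k}"

definition partial :: "nat \<Rightarrow> cpoly \<Rightarrow> cpoly" where
  "partial i p = (\<Sum>m\<in>Poly_Mapping.keys p.
     Poly_Mapping.single (m - Poly_Mapping.single i 1)
       (of_nat (Poly_Mapping.lookup m i) * Poly_Mapping.lookup p m))"

definition eval_at :: "(nat \<Rightarrow> complex) \<Rightarrow> cpoly \<Rightarrow> complex" where
  "eval_at a p = (\<Sum>m\<in>Poly_Mapping.keys p.
     Poly_Mapping.lookup p m * (\<Prod>i\<in>Poly_Mapping.keys m. a i ^ Poly_Mapping.lookup m i))"


section \<open>Quasi-smoothness\<close>

text \<open>Points of affine \<open>n\<close>-space are extended by zero, so the origin is \<open>\<lambda>_. 0\<close>.\<close>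

definition affine_space :: "nat \<Rightarrow> (nat \<Rightarrow> complex) set" where
  "affine_space n = {a. \<forall>i\<ge>n. a i = 0}"

text \<open>Smoothness of the affine cone \<open>f = 0\<close> at its points other than the origin.\<close>

definition quasi_smooth :: "nat \<Rightarrow> cpoly \<Rightarrow> bool" where
  "quasi_smooth n f \<longleftrightarrow>
     (\<forall>a \<in> affine_space n - {\<lambda>_. 0}. eval_at a f = 0 \<longrightarrow> (\<exists>i<n. eval_at a (partial i f) \<noteq> 0))"


section \<open>The Jacobian ring and the differential of the period map\<close>

definition poly_ring :: "nat \<Rightarrow> cpoly ring" where
  "poly_ring n = \<lparr>carrier = polys n, mult = (*), one = 1, zero = 0, add = (+)\<rparr>"

definition jacobian_ideal :: "nat \<Rightarrow> cpoly \<Rightarrow> cpoly set" where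
  "jacobian_ideal n f = genideal (poly_ring n) ((\<lambda>i. partial i f) ` {..<n})"

definition jacobian_ring :: "nat \<Rightarrow> cpoly \<Rightarrow> cpoly set ring" where
  "jacobian_ring n f = poly_ring n Quot jacobian_ideal n f"

definition jacobian_piece :: "nat \<Rightarrow> (nat \<Rightarrow> nat) \<Rightarrow> cpoly \<Rightarrow> int \<Rightarrow> cpoly set set" where
  "jacobian_piece n w f k =
     (\<lambda>p. jacobian_ideal n f +>\<^bsub>poly_ring n\<^esub> p) ` homogeneous_polys n w k"

text \<open>
  For a hypersurface \<open>V(f)\<close> of degree \<open>d\<close> and dimension \<open>m = n - 2\<close>, and \<open>s\<close> the sum of the weights,
  the piece of degree \<open>(q + 1) d - s\<close> is the primitive cohomology of type \<open>(m - q, q)\<close>. The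
  differential of the period map sends \<open>u\<close> in degree \<open>d\<close> to the family, indexed by the \<open>q\<close> for
  which both \<open>(m - q, q)\<close> and \<open>(m - q - 1, q + 1)\<close> are Hodge types, of the maps
  \<open>v \<mapsto> u v\<close> on the piece of degree \<open>(q + 1) d - s\<close>.
\<close>

definition hodge_piece :: "nat \<Rightarrow> (nat \<Rightarrow> nat) \<Rightarrow> nat \<Rightarrow> cpoly \<Rightarrow> nat \<Rightarrow> cpoly set set" where
  "hodge_piece n w d f q = jacobian_piece n w f ((int q + 1) * int d - int (\<Sum>i<n. w i))"

definition period_differential ::
  "nat \<Rightarrow> (nat \<Rightarrow> nat) \<Rightarrow> nat \<Rightarrow> cpoly \<Rightarrow> cpoly set \<Rightarrow> nat \<Rightarrow> cpoly set \<Rightarrow> cpoly set" where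
  "period_differential n w d f u =
     (\<lambda>q\<in>{..<n - 2}. \<lambda>v\<in>hodge_piece n w d f q. u \<otimes>\<^bsub>jacobian_ring n f\<^esub> v)"

definition torelli_type :: "nat \<Rightarrow> (nat \<Rightarrow> nat) \<Rightarrow> nat \<Rightarrow> cpoly \<Rightarrow> bool" where
  "torelli_type n w d f \<longleftrightarrow>
     inj_on (period_differential n w d f) (jacobian_piece n w f (int d))"

definition anti_torelli_type :: "nat \<Rightarrow> (nat \<Rightarrow> nat) \<Rightarrow> nat \<Rightarrow> cpoly \<Rightarrow> bool" where
  "anti_torelli_type n w d f \<longleftrightarrow> \<not> torelli_type n w d f"


section \<open>Weighted projective spaces and double covers\<close>

definition act :: "(nat \<Rightarrow> nat) \<Rightarrow> complex \<Rightarrow> (nat \<Rightarrow> complex) \<Rightarrow> (nat \<Rightarrow> complex)" where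
  "act w t a = (\<lambda>i. t ^ w i * a i)"

definition wproj :: "nat \<Rightarrow> (nat \<Rightarrow> nat) \<Rightarrow> (nat \<Rightarrow> complex) set set" where
  "wproj n w = (affine_space n - {\<lambda>_. 0}) //
     {(a, b). a \<in> affine_space n - {\<lambda>_. 0} \<and> b \<in> affine_space n - {\<lambda>_. 0} \<and>
              (\<exists>t. t \<noteq> 0 \<and> b = act w t a)}"

definition hypersurface :: "nat \<Rightarrow> (nat \<Rightarrow> nat) \<Rightarrow> cpoly \<Rightarrow> (nat \<Rightarrow> complex) set set" where
  "hypersurface n w f = {P \<in> wproj n w. \<forall>a\<in>P. eval_at a f = 0}"

definition isotropy :: "(nat \<Rightarrow> nat) \<Rightarrow> (nat \<Rightarrow> complex) set \<Rightarrow> complex set" where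
  "isotropy w P = {t. t \<noteq> 0 \<and> (\<forall>a\<in>P. act w t a = a)}"

text \<open>
  The projection that forgets the coordinate with index \<open>n\<close>. A point is an orbit, and so is its image
  unless only that coordinate is nonzero; in this last case the image is \<open>{\<lambda>_. 0}\<close>, which is not a
  point of \<open>wproj n w\<close>.
\<close>

definition forget_coord :: "nat \<Rightarrow> (nat \<Rightarrow> complex) set \<Rightarrow> (nat \<Rightarrow> complex) set" where
  "forget_coord n P = (\<lambda>a. a(n := 0)) ` P"

text \<open>
  The projection exhibits \<open>V(f)\<close>, in \<open>n + 1\<close> variables, as a double cover of the weighted
  projective space in the first \<open>n\<close> variables with branch divisor \<open>V(g)\<close>. Away from \<open>V(g)\<close>, two
  preimages are required only where the isotropy is trivial: over \<open>P(2,4)\<close> inside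
  \<open>P(2,3,4,5,7,\<dots>)\<close> the isotropy element \<open>-1\<close> acts as \<open>-1\<close> on a coordinate of weight 7 and
  identifies the two preimages, without contributing to the branch divisor as this locus has
  codimension at least 2.
\<close>

definition double_cover_branched_over :: "nat \<Rightarrow> (nat \<Rightarrow> nat) \<Rightarrow> cpoly \<Rightarrow> cpoly \<Rightarrow> bool" where
  "double_cover_branched_over n w f g \<longleftrightarrow>
     forget_coord n ` hypersurface (Suc n) w f = wproj n w \<and>
     (\<forall>Q\<in>wproj n w.
        let fibre = {P \<in> hypersurface (Suc n) w f. forget_coord n P = Q} in
          card fibre \<in> {1, 2} \<and>
          (Q \<in> hypersurface n w g \<longrightarrow> card fibre = 1) \<and>
          (Q \<notin> hypersurface n w g \<and> isotropy w Q = {1} \<longrightarrow> card fibre = 2))"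


section \<open>The hypersurfaces of degree 14 in \<open>P(2,3,4,5,7,\<dots>,7)\<close>\<close>

definition gm_weight :: "nat \<Rightarrow> nat" where
  "gm_weight i = (if i < 4 then [2, 3, 4, 5] ! i else 7)"

definition gm_member :: "nat \<Rightarrow> cpoly \<Rightarrow> bool" where
  "gm_member j f \<longleftrightarrow> f \<in> homogeneous_polys (4 + j) gm_weight 14 \<and> quasi_smooth (4 + j) f"

definition gm_torelli :: "nat \<Rightarrow> cpoly \<Rightarrow> bool" where
  "gm_torelli j f \<longleftrightarrow> torelli_type (4 + j) gm_weight 14 f"

definition gm_anti_torelli :: "nat \<Rightarrow> cpoly \<Rightarrow> bool" where
  "gm_anti_torelli j f \<longleftrightarrow> anti_torelli_type (4 + j) gm_weight 14 f"

definition gm_tower :: "cpoly \<Rightarrow> nat \<Rightarrow> cpoly" where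
  "gm_tower f0 j = f0 + (\<Sum>i<j. (var (4 + i))\<^sup>2)"

end

theory Submission
  imports Defs "Jordan_Normal_Form.Determinant"
begin

text \<open>
  In even dimension \<open>m = 2k + 2\<close> the piece of type \<open>(m - k, k)\<close> is \<open>R_0\<close>, and multiplication by its
  unit recovers the deformation.

  In odd dimension all Hodge pieces have odd degree. Completing squares brings \<open>f\<close> into the form
  \<open>N(x, y, z, w) + Q(T)\<close> with \<open>x, y, z, w\<close> of weight 2, 3, 4, 5 and a nondegenerate quadratic form
  \<open>Q\<close> in coordinates \<open>T\<close> of weight 7. As the variables of odd weight are \<open>y\<close>, \<open>w\<close> and \<open>T\<close>, one
  can write \<open>N_w = A y + B w\<close> and \<open>N_y = C y + D w\<close>; by Cramer's rule \<open>\<Delta> = A D - B C\<close>, of degree 12,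
  multiplies \<open>y\<close> and \<open>w\<close> into the Jacobian ideal \<open>J\<close>. So \<open>x \<Delta>\<close>, of degree 14, annihilates every
  element of odd degree. If it were in \<open>J\<close>, then \<open>x \<Delta> = \<xi> N\<close> for a vector field \<open>\<xi>\<close> of
  weight 0; comparing coefficients, this contradicts smoothness of the cone over the four
  coordinate points of \<open>P(2,3,4,5)\<close>.
\<close>

section \<open>Polynomial arithmetic\<close>

text \<open>The determinant has degree 12, so its multiplier must have degree 2, where
  \<open>x\<close> is the only monomial. Two obstacles shape the rest. The normal form already needs
  quasi-smoothness twice: on the locus where only weight-7 coordinates survive it makes the
  quadratic form invertible, and at the point of weight 5 it makes the coefficient of
  \<open>z w^2\<close> nonzero, so that shifts of \<open>z\<close> and \<open>w\<close> can absorb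
  \<open>x^2 w^2\<close> and \<open>x y z w\<close>. Without these two monomials the comparison of
  coefficients kills at once the \<open>x^2\<close> and \<open>x y\<close> parts of the vector
  field, and only its four diagonal entries remain. The other obstacle is non-membership in an ideal
  whose number of generators grows with \<open>j\<close>. On the slice where all \<open>T i\<close>
  vanish, the derivatives in the weight-7 variables vanish too, and evaluation at its points leaves
  an identity of functions in four complex variables, independent of \<open>j\<close>. The
  coordinate change is never realised as an automorphism: \<open>Z\<close>, \<open>W\<close> and
  \<open>T i\<close> remain polynomials in the old variables, so there is a single Jacobian ideal
  throughout.\<close>

abbreviation single :: "'a \<Rightarrow> 'b \<Rightarrow> 'a \<Rightarrow>\<^sub>0 'b::zero" where
  "single \<equiv> Poly_Mapping.single"

abbreviation lookup :: "('a \<Rightarrow>\<^sub>0 'b::zero) \<Rightarrow> 'a \<Rightarrow> 'b" where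
  "lookup \<equiv> Poly_Mapping.lookup"

abbreviation keys :: "('a \<Rightarrow>\<^sub>0 'b::zero) \<Rightarrow> 'a set" where
  "keys \<equiv> Poly_Mapping.keys"

definition cst :: "complex \<Rightarrow> cpoly" where
  "cst c = single 0 c"

lemma cst_add: "cst (a + b) = cst a + cst b"
  and cst_mult: "cst (a * b) = cst a * cst b"
  and cst_0 [simp]: "cst 0 = 0"
  and cst_1 [simp]: "cst 1 = 1"
  and cst_minus: "cst (- a) = - cst a"
  by (simp_all add: cst_def single_add mult_single single_uminus)

lemma cst_diff: "cst (a - b) = cst a - cst b"
  by (simp add: cst_def single_diff)

lemma cst_numeral [simp]: "cst (numeral n) = numeral n"
  by (simp add: cst_def)

lemma cst_power: "cst (a ^ n) = cst a ^ n"
  by (induction n) (simp_all add: cst_mult)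

lemma cst_sum: "cst (sum h A) = (\<Sum>i\<in>A. cst (h i))"
  by (induction A rule: infinite_finite_induct) (simp_all add: cst_add)

text \<open>Reduces bilinear identities, such as multiplicativity of evaluation and the Leibniz
  rule, to pairs of single monomials.\<close>

lemma poly_mapping_induct_single_add [case_names single add]:
  fixes p :: "'a \<Rightarrow>\<^sub>0 'b::monoid_add"
  assumes single: "\<And>m c. P (single m c)" and add: "\<And>p q. P p \<Longrightarrow> P q \<Longrightarrow> P (p + q)"
  shows "P p"
proof (induction p rule: update_induct)
  case const
  show ?case using single[of undefined 0] by simp
next
  case (update f a b)
  have "Poly_Mapping.update a b f = f + single a b"
    using update.hyps
    by (intro poly_mapping_eqI) (auto simp: lookup_add lookup_update lookup_single when_def in_keys_iff)
  then show ?case using update single add by simp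
qed

lemma sum_keys_superset:
  assumes "finite A" "keys p \<subseteq> A" "\<And>m. h m 0 = 0"
  shows "(\<Sum>m\<in>keys p. h m (lookup p m)) = (\<Sum>m\<in>A. h m (lookup p m))"
  by (rule sum.mono_neutral_left) (use assms in \<open>auto simp: in_keys_iff\<close>)

text \<open>Cancellation can make the support of \<open>p + q\<close> smaller than the union of the
  supports; since \<open>h m 0 = 0\<close>, all three sums can be taken over that union. Evaluation,
  derivatives and weighted degrees are all sums of this kind.\<close>

lemma sum_keys_add:
  fixes h :: "'a \<Rightarrow> 'b::monoid_add \<Rightarrow> 'c::comm_monoid_add"
  assumes "\<And>m. h m 0 = 0" "\<And>m b c. h m (b + c) = h m b + h m c"
  shows "(\<Sum>m\<in>keys (p + q). h m (lookup (p + q) m))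
       = (\<Sum>m\<in>keys p. h m (lookup p m)) + (\<Sum>m\<in>keys q. h m (lookup q m))"
proof -
  let ?A = "keys p \<union> keys q"
  have "keys (p + q) \<subseteq> ?A" by (rule Poly_Mapping.keys_add)
  then have "(\<Sum>m\<in>keys (p + q). h m (lookup (p + q) m)) = (\<Sum>m\<in>?A. h m (lookup (p + q) m))"
    by (intro sum_keys_superset) (use assms in auto)
  also have "\<dots> = (\<Sum>m\<in>?A. h m (lookup p m)) + (\<Sum>m\<in>?A. h m (lookup q m))"
    by (simp add: lookup_add assms sum.distrib)
  also have "\<dots> = (\<Sum>m\<in>keys p. h m (lookup p m)) + (\<Sum>m\<in>keys q. h m (lookup q m))"
    using sum_keys_superset[of ?A p h] sum_keys_superset[of ?A q h] assms by simp
  finally show ?thesis .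
qed

subsection \<open>Evaluation\<close>

definition eval_mono :: "(nat \<Rightarrow> complex) \<Rightarrow> mono \<Rightarrow> complex" where
  "eval_mono a m = (\<Prod>i\<in>keys m. a i ^ lookup m i)"

lemma eval_mono_superset:
  assumes "finite A" "keys m \<subseteq> A"
  shows "eval_mono a m = (\<Prod>i\<in>A. a i ^ lookup m i)"
  unfolding eval_mono_def
  by (rule prod.mono_neutral_left) (use assms in \<open>auto simp: in_keys_iff\<close>)

lemma eval_mono_add: "eval_mono a (m + m') = eval_mono a m * eval_mono a m'"
proof -
  let ?A = "keys m \<union> keys m'"
  have "eval_mono a (m + m') = (\<Prod>i\<in>?A. a i ^ lookup (m + m') i)"
    by (rule eval_mono_superset) (use Poly_Mapping.keys_add[of m m'] in auto)
  also have "\<dots> = eval_mono a m * eval_mono a m'"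
    by (simp add: lookup_add power_add prod.distrib eval_mono_superset[of ?A])
  finally show ?thesis .
qed

lemma eval_mono_0 [simp]: "eval_mono a 0 = 1"
  by (simp add: eval_mono_def)

lemma eval_at_eval_mono: "eval_at a p = (\<Sum>m\<in>keys p. lookup p m * eval_mono a m)"
  by (simp add: eval_at_def eval_mono_def)

lemma eval_at_add [simp]: "eval_at a (p + q) = eval_at a p + eval_at a q"
  unfolding eval_at_eval_mono by (rule sum_keys_add) (simp_all add: algebra_simps)

lemma eval_at_single: "eval_at a (single m c) = c * eval_mono a m"
  by (simp add: eval_at_eval_mono)

lemma eval_at_mult [simp]: "eval_at a (p * q) = eval_at a p * eval_at a q"
proof (induction p rule: poly_mapping_induct_single_add)
  case (single m c)
  show ?case
  proof (induction q rule: poly_mapping_induct_single_add)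
    case (single m' c')
    show ?case by (simp add: mult_single eval_at_single eval_mono_add)
  qed (simp add: algebra_simps)
qed (simp add: algebra_simps)

lemma eval_at_0 [simp]: "eval_at a 0 = 0"
  by (simp add: eval_at_def)

lemma eval_at_cst [simp]: "eval_at a (cst c) = c"
  by (simp add: cst_def eval_at_single)

lemma eval_at_1 [simp]: "eval_at a 1 = 1"
  using eval_at_cst[of a 1] by (simp del: eval_at_cst)

lemma eval_at_numeral [simp]: "eval_at a (numeral n) = numeral n"
  using eval_at_cst[of a "numeral n"] by (simp del: eval_at_cst)

lemma eval_at_diff [simp]: "eval_at a (p - q) = eval_at a p - eval_at a q"
  using eval_at_add[of a "p - q" q] by (simp del: eval_at_add)

lemma eval_at_power [simp]: "eval_at a (p ^ n) = eval_at a p ^ n"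
  by (induction n) simp_all

lemma eval_at_sum [simp]: "eval_at a (sum h A) = (\<Sum>i\<in>A. eval_at a (h i))"
  by (induction A rule: infinite_finite_induct) simp_all

lemma eval_at_var [simp]: "eval_at a (var i) = a i"
  by (simp add: var_def eval_at_single eval_mono_def)

subsection \<open>Partial derivatives\<close>

lemma partial_add [simp]: "partial i (p + q) = partial i p + partial i q"
  unfolding partial_def
  by (rule sum_keys_add[where h = "\<lambda>m c. single (m - single i 1) (of_nat (lookup m i) * c)"])
    (simp_all add: ring_distribs single_add)

lemma partial_single: "partial i (single m c) = single (m - single i 1) (of_nat (lookup m i) * c)"
  by (simp add: partial_def)

text \<open>Subtraction of exponents is truncated, so the variable must occur in
  \<open>m\<close>.\<close>

lemma minus_single_add:
  fixes m m' :: mono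
  assumes "lookup m i \<noteq> 0"
  shows "m + m' - single i 1 = (m - single i 1) + m'"
  using assms by (intro poly_mapping_eqI) (auto simp: lookup_add lookup_minus lookup_single when_def)

lemma partial_mult_single:
  "partial i (single m c * single m' c')
     = partial i (single m c) * single m' c' + single m c * partial i (single m' c')"
proof -
  \<comment> \<open>If variable \<open>i\<close> does not occur, truncation may spoil the exponent,
    but then the coefficient is 0 and both sides vanish.\<close>
  have left: "single (m + m' - single i 1) (of_nat (lookup m i) * c * c')
      = single ((m - single i 1) + m') (of_nat (lookup m i) * c * c')"
    using minus_single_add[of m i m'] by (cases "lookup m i = 0") auto
  have right: "single (m + m' - single i 1) (c * (of_nat (lookup m' i) * c'))
      = single (m + (m' - single i 1)) (c * (of_nat (lookup m' i) * c'))"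
    using minus_single_add[of m' i m] by (cases "lookup m' i = 0") (auto simp: add.commute)
  show ?thesis
    unfolding partial_single mult_single left[symmetric] right[symmetric] single_add[symmetric]
    by (simp only: lookup_add of_nat_add ring_distribs mult.assoc mult.left_commute)
qed

lemma partial_mult [simp]: "partial i (p * q) = partial i p * q + p * partial i q"
proof (induction p rule: poly_mapping_induct_single_add)
  case (single m c)
  show ?case
    by (induction q rule: poly_mapping_induct_single_add)
      (simp_all add: partial_mult_single algebra_simps)
qed (simp add: algebra_simps)

lemma partial_cst [simp]: "partial i (cst c) = 0"
  by (simp add: cst_def partial_single)

lemma partial_0 [simp]: "partial i 0 = 0"
  by (simp add: partial_def)

lemma partial_1 [simp]: "partial i 1 = 0"
  using partial_cst[of i 1] by (simp del: partial_cst)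

lemma partial_power [simp]: "partial i (p ^ n) = of_nat n * p ^ (n - 1) * partial i p"
proof (induction n)
  case (Suc n)
  then show ?case by (cases n) (simp_all add: algebra_simps)
qed simp

lemma partial_sum [simp]: "partial i (sum h A) = (\<Sum>k\<in>A. partial i (h k))"
  by (induction A rule: infinite_finite_induct) simp_all

lemma partial_var [simp]: "partial i (var k) = (if i = k then 1 else 0)"
  by (auto simp: var_def partial_single lookup_single when_def single_diff[symmetric]
      simp del: single_diff)

subsection \<open>Polynomials in finitely many variables\<close>

lemma polys_add: "p \<in> polys n \<Longrightarrow> q \<in> polys n \<Longrightarrow> p + q \<in> polys n"
  unfolding polys_def using Poly_Mapping.keys_add[of p q] by blast

lemma polys_uminus: "p \<in> polys n \<Longrightarrow> - p \<in> polys n"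
  unfolding polys_def by (auto simp: in_keys_iff)

lemma polys_diff: "p \<in> polys n \<Longrightarrow> q \<in> polys n \<Longrightarrow> p - q \<in> polys n"
  using polys_add[OF _ polys_uminus] by force

lemma polys_mult: "p \<in> polys n \<Longrightarrow> q \<in> polys n \<Longrightarrow> p * q \<in> polys n"
  unfolding polys_def
  using Poly_Mapping.keys_mult[of p q] Poly_Mapping.keys_add[where ?'a = nat and ?'b = nat]
  by (smt (verit, ccfv_threshold) Un_iff mem_Collect_eq subset_iff)

lemma polys_cst: "cst c \<in> polys n"
  by (auto simp: polys_def cst_def)

lemma polys_0: "0 \<in> polys n" and polys_1: "1 \<in> polys n"
  and polys_numeral: "numeral k \<in> polys n"
  using polys_cst[of 0 n] polys_cst[of 1 n] polys_cst[of "numeral k" n] by simp_all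

lemma polys_var: "i < n \<Longrightarrow> var i \<in> polys n"
  by (auto simp: polys_def var_def)

lemma polys_power: "p \<in> polys n \<Longrightarrow> p ^ k \<in> polys n"
  by (induction k) (auto intro: polys_1 polys_mult)

lemma polys_sum: "(\<And>i. i \<in> A \<Longrightarrow> h i \<in> polys n) \<Longrightarrow> sum h A \<in> polys n"
  by (induction A rule: infinite_finite_induct) (auto intro: polys_0 polys_add)

lemmas polys_intros = polys_add polys_diff polys_uminus polys_mult polys_cst polys_0 polys_1
  polys_numeral polys_var polys_power polys_sum

lemma polys_single: "keys m \<subseteq> {..<n} \<Longrightarrow> single m c \<in> polys n"
  by (auto simp: polys_def)

lemma polys_partial:
  assumes "p \<in> polys n" shows "partial i p \<in> polys n"
  unfolding partial_def
proof (intro polys_sum polys_single)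
  fix m assume "m \<in> keys p"
  then have "keys m \<subseteq> {..<n}" using assms by (auto simp: polys_def)
  then show "keys (m - single i 1) \<subseteq> {..<n}"
    unfolding subset_iff in_keys_iff lookup_minus by (metis diff_0_eq_0)
qed

subsection \<open>Weighted degrees\<close>

lemma weighted_deg_add: "weighted_deg w (m + m') = weighted_deg w m + weighted_deg w m'"
  unfolding weighted_deg_def by (rule sum_keys_add) (simp_all add: algebra_simps)

lemma weighted_deg_single [simp]: "weighted_deg w (single i k) = w i * k"
  by (simp add: weighted_deg_def)

lemma weighted_deg_0 [simp]: "weighted_deg w 0 = 0"
  by (simp add: weighted_deg_def)

section \<open>The Jacobian ideal\<close>

lemma poly_ring_simps [simp]:
  "carrier (poly_ring n) = polys n" "p \<otimes>\<^bsub>poly_ring n\<^esub> q = p * q" "\<one>\<^bsub>poly_ring n\<^esub> = 1"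
  "\<zero>\<^bsub>poly_ring n\<^esub> = 0" "p \<oplus>\<^bsub>poly_ring n\<^esub> q = p + q"
  by (simp_all add: poly_ring_def)

lemma cring_poly_ring: "cring (poly_ring n)"
proof (intro cringI abelian_groupI comm_monoidI)
  fix p assume "p \<in> carrier (poly_ring n)"
  then show "\<exists>q\<in>carrier (poly_ring n). q \<oplus>\<^bsub>poly_ring n\<^esub> p = \<zero>\<^bsub>poly_ring n\<^esub>"
    by (intro bexI[of _ "- p"]) (simp_all add: polys_uminus)
qed (auto intro: polys_intros simp: algebra_simps)

locale jacobian =
  fixes n :: nat and f :: cpoly
  assumes f_polys: "f \<in> polys n"
begin

abbreviation J :: "cpoly set" where "J \<equiv> jacobian_ideal n f"

sublocale cring "poly_ring n"
  by (rule cring_poly_ring)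

lemma ideal_J: "ideal J (poly_ring n)"
  unfolding jacobian_ideal_def
  by (rule genideal_ideal) (auto intro: polys_partial f_polys)

sublocale J: ideal J "poly_ring n"
  by (rule ideal_J)

lemma J_partial: "i < n \<Longrightarrow> partial i f \<in> J"
  unfolding jacobian_ideal_def
  using genideal_self[of "(\<lambda>i. partial i f) ` {..<n}"]
  by (auto intro: polys_partial f_polys)

lemma J_0: "0 \<in> J"
  using J.zero_closed by simp

lemma J_add: "p \<in> J \<Longrightarrow> q \<in> J \<Longrightarrow> p + q \<in> J"
  using J.a_closed[of p q] by simp

lemma J_mult_left: "p \<in> J \<Longrightarrow> r \<in> polys n \<Longrightarrow> r * p \<in> J"
  using J.I_l_closed[of p r] by simp

lemma J_mult_right: "p \<in> J \<Longrightarrow> r \<in> polys n \<Longrightarrow> p * r \<in> J"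
  using J.I_r_closed[of p r] by simp

lemma J_uminus: "p \<in> J \<Longrightarrow> - p \<in> J"
  using J_mult_left[of p "- 1"] by (simp add: polys_uminus polys_1)

lemma J_diff: "p \<in> J \<Longrightarrow> q \<in> J \<Longrightarrow> p - q \<in> J"
  using J_add[OF _ J_uminus, of p q] by simp

lemma J_sum: "(\<And>i. i \<in> A \<Longrightarrow> h i \<in> J) \<Longrightarrow> sum h A \<in> J"
  by (induction A rule: infinite_finite_induct) (auto intro: J_0 J_add)

text \<open>The generated ideal is the least one containing the partial derivatives, so it suffices
  that their combinations form an ideal containing each of them.\<close>

lemma J_combination:
  assumes "p \<in> J"
  obtains h where "\<And>i. i < n \<Longrightarrow> h i \<in> polys n" "p = (\<Sum>i<n. h i * partial i f)"
proof -
  let ?I = "{p. \<exists>h. (\<forall>i<n. h i \<in> polys n) \<and> p = (\<Sum>i<n. h i * partial i f)}"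
  have sub: "?I \<subseteq> polys n"
    by (auto intro!: polys_sum polys_mult polys_partial f_polys)
  have add: "p + q \<in> ?I" if "p \<in> ?I" "q \<in> ?I" for p q
  proof -
    from that obtain h h' where "\<forall>i<n. h i \<in> polys n" "p = (\<Sum>i<n. h i * partial i f)"
      "\<forall>i<n. h' i \<in> polys n" "q = (\<Sum>i<n. h' i * partial i f)" by blast
    then show ?thesis
      by (intro CollectI exI[of _ "\<lambda>i. h i + h' i"])
        (auto intro: polys_add simp: sum.distrib ring_distribs)
  qed
  have mult: "r * p \<in> ?I" if "p \<in> ?I" "r \<in> polys n" for p r
  proof -
    from that obtain h where "\<forall>i<n. h i \<in> polys n" "p = (\<Sum>i<n. h i * partial i f)" by blast
    then show ?thesis using that
      by (intro CollectI exI[of _ "\<lambda>i. r * h i"])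
        (auto intro: polys_mult simp: sum_distrib_left mult.assoc)
  qed
  have zero: "0 \<in> ?I"
    by (intro CollectI exI[of _ "\<lambda>i. 0"]) (auto intro: polys_0)
  have "ideal ?I (poly_ring n)"
  proof (rule idealI)
    show "Ring.ring (poly_ring n)" by (rule ring_axioms)
    show "subgroup ?I (add_monoid (poly_ring n))"
    proof (rule group.subgroupI)
      show "Group.group (add_monoid (poly_ring n))" by (rule add.group_axioms)
      fix p assume p: "p \<in> ?I"
      have "inv\<^bsub>add_monoid (poly_ring n)\<^esub> p = - p"
        using p sub minus_equality[of "- p" p] by (auto simp: a_inv_def polys_uminus)
      moreover have "(- 1) * p \<in> ?I" using p by (intro mult) (auto intro: polys_uminus polys_1)
      ultimately show "inv\<^bsub>add_monoid (poly_ring n)\<^esub> p \<in> ?I" by simp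
    qed (use sub zero add in auto)
  qed (use mult in \<open>auto simp: mult.commute\<close>)
  moreover have "(\<lambda>i. partial i f) ` {..<n} \<subseteq> ?I"
  proof clarify
    fix i assume "i < n"
    then show "\<exists>h. (\<forall>i<n. h i \<in> polys n) \<and> partial i f = (\<Sum>i<n. h i * partial i f)"
      by (intro exI[of _ "\<lambda>k. if k = i then 1 else 0"])
        (auto intro: polys_0 polys_1 simp: if_distrib[of "\<lambda>x. x * _"] cong: if_cong)
  qed
  ultimately have "J \<subseteq> ?I"
    unfolding jacobian_ideal_def by (rule genideal_minimal)
  with assms that show thesis by blast
qed

section \<open>Classes in the Jacobian ring and criteria for the Torelli property\<close>

lemma coset_eq_iff:
  assumes "p \<in> polys n" "q \<in> polys n"
  shows "J +>\<^bsub>poly_ring n\<^esub> p = J +>\<^bsub>poly_ring n\<^esub> q \<longleftrightarrow> p - q \<in> J"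
proof -
  have "q \<ominus>\<^bsub>poly_ring n\<^esub> p = q - p" if "p \<in> polys n" "q \<in> polys n" for p q
    using that minus_equality[of "- p" p] by (simp add: a_minus_def polys_uminus)
  then show ?thesis
    using quotient_eq_iff_same_a_r_cos[OF ideal_J, of p q] assms by simp
qed

lemma coset_mult:
  assumes "p \<in> polys n" "q \<in> polys n"
  shows "(J +>\<^bsub>poly_ring n\<^esub> p) \<otimes>\<^bsub>jacobian_ring n f\<^esub> (J +>\<^bsub>poly_ring n\<^esub> q) = J +>\<^bsub>poly_ring n\<^esub> (p * q)"
  using J.rcoset_mult_add[of p q] assms by (simp add: jacobian_ring_def FactRing_def)

lemma torelli_typeI:
  assumes q: "q < n - 2" "(q + 1) * d = (\<Sum>i<n. w i)"
  shows "torelli_type n w d f"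
  unfolding torelli_type_def
proof (rule inj_onI)
  fix u u' assume u: "u \<in> jacobian_piece n w f (int d)" "u' \<in> jacobian_piece n w f (int d)"
    and eq: "period_differential n w d f u = period_differential n w d f u'"
  have "(int q + 1) * int d - int (\<Sum>i<n. w i) = 0"
    by (simp add: q(2)[symmetric] algebra_simps)
  moreover have "1 \<in> homogeneous_polys n w 0"
    by (simp add: homogeneous_polys_def polys_1)
  ultimately have one: "J +>\<^bsub>poly_ring n\<^esub> 1 \<in> hodge_piece n w d f q"
    unfolding hodge_piece_def jacobian_piece_def by simp
  have unit: "u \<otimes>\<^bsub>jacobian_ring n f\<^esub> (J +>\<^bsub>poly_ring n\<^esub> 1) = u"
    if "u \<in> jacobian_piece n w f (int d)" for u
    using that by (auto simp: jacobian_piece_def homogeneous_polys_def coset_mult polys_1)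
  show "u = u'"
    using fun_cong[OF fun_cong[OF eq, of q], of "J +>\<^bsub>poly_ring n\<^esub> 1"] q one
    by (simp add: period_differential_def unit u)
qed

text \<open>The pair violating injectivity consists of the class of \<open>u\<close> and the class
  of 0: both multiply every Hodge piece to zero.\<close>

lemma anti_torelli_typeI:
  assumes u: "u \<in> homogeneous_polys n w (int d)" "u \<notin> J"
    and annihilates: "\<And>q r. q < n - 2 \<Longrightarrow>
      r \<in> homogeneous_polys n w ((int q + 1) * int d - int (\<Sum>i<n. w i)) \<Longrightarrow> u * r \<in> J"
  shows "anti_torelli_type n w d f"
  unfolding anti_torelli_type_def torelli_type_def
proof
  let ?c = "\<lambda>p. J +>\<^bsub>poly_ring n\<^esub> p"
  assume inj: "inj_on (period_differential n w d f) (jacobian_piece n w f (int d))"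
  have u_polys: "u \<in> polys n" and zero: "0 \<in> homogeneous_polys n w (int d)"
    using u by (auto simp: homogeneous_polys_def polys_0)
  have "?c u \<otimes>\<^bsub>jacobian_ring n f\<^esub> v = ?c 0 \<otimes>\<^bsub>jacobian_ring n f\<^esub> v"
    if q: "q < n - 2" and v: "v \<in> hodge_piece n w d f q" for q v
  proof -
    obtain r where r: "v = ?c r" "r \<in> homogeneous_polys n w ((int q + 1) * int d - int (\<Sum>i<n. w i))"
      using v by (auto simp: hodge_piece_def jacobian_piece_def)
    then have "r \<in> polys n" by (simp add: homogeneous_polys_def)
    moreover have "?c (u * r) = ?c (0 * r)"
      using calculation annihilates[OF q r(2)] u_polys by (subst coset_eq_iff) (auto intro: polys_mult polys_0)
    ultimately show ?thesis by (simp add: r(1) coset_mult u_polys polys_0)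
  qed
  then have "period_differential n w d f (?c u) = period_differential n w d f (?c 0)"
    unfolding period_differential_def by (auto intro!: restrict_ext)
  then have "?c u = ?c 0"
    using u(1) zero by (intro inj_onD[OF inj]) (auto simp: jacobian_piece_def)
  then show False
    using u(2) u_polys by (simp add: coset_eq_iff polys_0)
qed

end

section \<open>Graded parts of combinations of partial derivatives\<close>

lemma homogeneous_polys_partial_mult_keys:
  assumes f: "f \<in> homogeneous_polys n w (int d)" and m: "m \<in> keys (h * partial i f)"
  obtains m' where "m' \<in> keys h" "weighted_deg w m + w i = weighted_deg w m' + d"
proof -
  obtain m1 m2 where m12: "m1 \<in> keys h" "m2 \<in> keys (partial i f)" "m = m1 + m2"
    using m Poly_Mapping.keys_mult[of h "partial i f"] by blast
  have "keys (partial i f) \<subseteq> (\<Union>m\<in>keys f. keys (single (m - single i 1)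
       (of_nat (lookup m i) * lookup f m)))"
    unfolding partial_def by (rule keys_sum)
  with m12(2) obtain m3 where m3': "m3 \<in> keys f"
    "m2 \<in> keys (single (m3 - single i 1) (of_nat (lookup m3 i) * lookup f m3))" by blast
  then have m3: "m3 \<in> keys f" "lookup m3 i \<noteq> 0" "m2 = m3 - single i 1"
    by (simp_all split: if_splits)
  have "m3 = m2 + single i 1"
    using m3 by (intro poly_mapping_eqI) (auto simp: lookup_add lookup_minus lookup_single when_def)
  moreover have "weighted_deg w m3 = d"
    using f m3(1) by (auto simp: homogeneous_polys_def)
  ultimately have "weighted_deg w m2 + w i = d"
    by (simp add: weighted_deg_add)
  with m12 that show thesis by (simp add: weighted_deg_add)
qed

text \<open>With a degree condition for \<open>P\<close> this is the projection to a homogeneous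
  component.\<close>

definition restrict_keys :: "('a \<Rightarrow> bool) \<Rightarrow> ('a \<Rightarrow>\<^sub>0 'b) \<Rightarrow> 'a \<Rightarrow>\<^sub>0 'b::comm_monoid_add" where
  "restrict_keys P p = (\<Sum>m\<in>{m\<in>keys p. P m}. single m (lookup p m))"

lemma lookup_restrict_keys: "lookup (restrict_keys P p) m = (if P m then lookup p m else 0)"
proof -
  have "lookup (restrict_keys P p) m = (\<Sum>k\<in>{m\<in>keys p. P m}. if k = m then lookup p m else 0)"
    unfolding restrict_keys_def lookup_sum
    by (rule sum.cong) (auto simp: lookup_single when_def)
  then show ?thesis by (auto simp: in_keys_iff)
qed

lemma keys_restrict_keys: "keys (restrict_keys P p) = {m\<in>keys p. P m}"
  by (rule Set.set_eqI) (simp add: in_keys_iff lookup_restrict_keys)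

lemma restrict_keys_split: "restrict_keys P p + restrict_keys (\<lambda>m. \<not> P m) p = p"
  by (rule poly_mapping_eqI) (simp add: lookup_add lookup_restrict_keys)

text \<open>The part of \<open>h i\<close> of degree different from \<open>w i\<close> contributes
  only monomials of degree different from \<open>d\<close>. It must therefore cancel in total, and
  dropping it leaves a vector field of weight 0, which has few coefficients.\<close>

lemma (in jacobian) J_combination_homogeneous:
  assumes f: "f \<in> homogeneous_polys n w (int d)"
    and p: "p \<in> homogeneous_polys n w (int d)" "p \<in> J"
  obtains h where "\<And>i. i < n \<Longrightarrow> h i \<in> homogeneous_polys n w (int (w i))"
    "p = (\<Sum>i<n. h i * partial i f)"
proof -
  obtain h where h: "\<And>i. i < n \<Longrightarrow> h i \<in> polys n" "p = (\<Sum>i<n. h i * partial i f)"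
    by (rule J_combination[OF p(2)]) blast
  define h1 h2 where "h1 i = restrict_keys (\<lambda>m. weighted_deg w m = w i) (h i)"
    and "h2 i = restrict_keys (\<lambda>m. \<not> weighted_deg w m = w i) (h i)" for i
  have h12: "h i = h1 i + h2 i" "keys (h1 i) = {m\<in>keys (h i). weighted_deg w m = w i}"
    "keys (h2 i) = {m\<in>keys (h i). weighted_deg w m \<noteq> w i}" for i
    by (simp_all add: h1_def h2_def restrict_keys_split keys_restrict_keys)
  let ?p1 = "\<Sum>i<n. h1 i * partial i f" and ?p2 = "\<Sum>i<n. h2 i * partial i f"
  have eq: "p - ?p1 = ?p2"
    unfolding h(2) h12(1) by (simp add: ring_distribs sum.distrib)
  have keys_sum': "\<exists>i<n. m \<in> keys (g i)" if "m \<in> keys (\<Sum>i<n. g i)" for g :: "nat \<Rightarrow> cpoly" and m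
    using that keys_sum[of g "{..<n}"] by auto
  have "weighted_deg w m \<noteq> d" if "m \<in> keys ?p2" for m
  proof -
    obtain i where "i < n" "m \<in> keys (h2 i * partial i f)" using keys_sum'[OF \<open>m \<in> keys ?p2\<close>] by blast
    then obtain m' where "m' \<in> keys (h2 i)" "weighted_deg w m + w i = weighted_deg w m' + d"
      using homogeneous_polys_partial_mult_keys[OF f] by blast
    then show ?thesis using h12(3)[of i] by auto
  qed
  moreover have "weighted_deg w m = d" if "m \<in> keys (p - ?p1)" for m
  proof -
    have "m \<in> keys p \<or> m \<in> keys ?p1"
      using that by (auto simp: in_keys_iff lookup_minus)
    then show ?thesis
    proof
      assume "m \<in> keys p" then show ?thesis using p(1) by (auto simp: homogeneous_polys_def)
    next
      assume "m \<in> keys ?p1"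
      then obtain i where "i < n" "m \<in> keys (h1 i * partial i f)" using keys_sum' by blast
      then obtain m' where "m' \<in> keys (h1 i)" "weighted_deg w m + w i = weighted_deg w m' + d"
        using homogeneous_polys_partial_mult_keys[OF f] by blast
      then show ?thesis using h12(2)[of i] by simp
    qed
  qed
  ultimately have "keys (p - ?p1) = {}" unfolding eq by blast
  then have "p = ?p1" by simp
  moreover have "h1 i \<in> homogeneous_polys n w (int (w i))" if "i < n" for i
    using h(1)[OF that] h12(2)[of i] by (auto simp: homogeneous_polys_def polys_def)
  ultimately show thesis using that by blast
qed

section \<open>A normal form for polynomials of degree 14 in \<open>P(2,3,4,5)\<close>\<close>

text \<open>Of the thirteen monomials of degree 14 in weights 2, 3, 4, 5, the two missing ones,
  \<open>x^2 * w^2\<close> and \<open>x * y * z * w\<close>, can be removed by shifting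
  \<open>z\<close> and \<open>w\<close>. The base ring is arbitrary so that the same formula serves
  for polynomials and for their complex values.\<close>

definition nf :: "(nat \<Rightarrow> 'a::comm_ring_1) \<Rightarrow> 'a \<Rightarrow> 'a \<Rightarrow> 'a \<Rightarrow> 'a \<Rightarrow> 'a" where
  "nf g x y z w = g 0 * z * w^2 + g 1 * y^3 * w + g 2 * x^3 * y * w + g 3 * x^7 + g 4 * x^5 * z
     + g 5 * x^3 * z^2 + g 6 * x * z^3 + g 7 * x^4 * y^2 + g 8 * x^2 * y^2 * z + g 9 * y^2 * z^2
     + g 10 * x * y^4"

definition nf_x :: "(nat \<Rightarrow> 'a::comm_ring_1) \<Rightarrow> 'a \<Rightarrow> 'a \<Rightarrow> 'a \<Rightarrow> 'a \<Rightarrow> 'a" where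
  "nf_x g x y z w = 3 * g 2 * x^2 * y * w + 7 * g 3 * x^6 + 5 * g 4 * x^4 * z + 3 * g 5 * x^2 * z^2
     + g 6 * z^3 + 4 * g 7 * x^3 * y^2 + 2 * g 8 * x * y^2 * z + g 10 * y^4"

definition nf_z :: "(nat \<Rightarrow> 'a::comm_ring_1) \<Rightarrow> 'a \<Rightarrow> 'a \<Rightarrow> 'a \<Rightarrow> 'a \<Rightarrow> 'a" where
  "nf_z g x y z w = g 0 * w^2 + g 4 * x^5 + 2 * g 5 * x^3 * z + 3 * g 6 * x * z^2 + g 8 * x^2 * y^2
     + 2 * g 9 * y^2 * z"

text \<open>The derivatives in the odd variables \<open>y\<close>, \<open>w\<close> have odd degree, so they are linear
  combinations of \<open>y\<close> and \<open>w\<close>.\<close>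

definition nf_wy :: "(nat \<Rightarrow> 'a::comm_ring_1) \<Rightarrow> 'a \<Rightarrow> 'a \<Rightarrow> 'a \<Rightarrow> 'a" where
  "nf_wy g x y z = g 1 * y^2 + g 2 * x^3"

definition nf_ww :: "(nat \<Rightarrow> 'a::comm_ring_1) \<Rightarrow> 'a \<Rightarrow> 'a \<Rightarrow> 'a \<Rightarrow> 'a" where
  "nf_ww g x y z = 2 * g 0 * z"

definition nf_yy :: "(nat \<Rightarrow> 'a::comm_ring_1) \<Rightarrow> 'a \<Rightarrow> 'a \<Rightarrow> 'a \<Rightarrow> 'a" where
  "nf_yy g x y z = 2 * g 7 * x^4 + 2 * g 8 * x^2 * z + 2 * g 9 * z^2 + 4 * g 10 * x * y^2"

definition nf_yw :: "(nat \<Rightarrow> 'a::comm_ring_1) \<Rightarrow> 'a \<Rightarrow> 'a \<Rightarrow> 'a \<Rightarrow> 'a" where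
  "nf_yw g x y z = 3 * g 1 * y^2 + g 2 * x^3"

definition nf_y :: "(nat \<Rightarrow> 'a::comm_ring_1) \<Rightarrow> 'a \<Rightarrow> 'a \<Rightarrow> 'a \<Rightarrow> 'a \<Rightarrow> 'a" where
  "nf_y g x y z w = nf_yy g x y z * y + nf_yw g x y z * w"

definition nf_w :: "(nat \<Rightarrow> 'a::comm_ring_1) \<Rightarrow> 'a \<Rightarrow> 'a \<Rightarrow> 'a \<Rightarrow> 'a \<Rightarrow> 'a" where
  "nf_w g x y z w = nf_wy g x y z * y + nf_ww g x y z * w"

definition nf_det :: "(nat \<Rightarrow> 'a::comm_ring_1) \<Rightarrow> 'a \<Rightarrow> 'a \<Rightarrow> 'a \<Rightarrow> 'a" where
  "nf_det g x y z = nf_wy g x y z * nf_yw g x y z - nf_ww g x y z * nf_yy g x y z"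

lemmas nf_defs = nf_def nf_x_def nf_y_def nf_z_def nf_w_def nf_wy_def nf_ww_def nf_yy_def nf_yw_def

lemma nf_det_mult_y: "nf_det g x y z * y = nf_yw g x y z * nf_w g x y z w - nf_ww g x y z * nf_y g x y z w"
  and nf_det_mult_w: "nf_det g x y z * w = nf_wy g x y z * nf_y g x y z w - nf_yy g x y z * nf_w g x y z w"
  by (simp_all add: nf_det_def nf_y_def nf_w_def algebra_simps)

lemma eval_at_nf:
  "eval_at a (nf (\<lambda>i. cst (g i)) x y z w) = nf g (eval_at a x) (eval_at a y) (eval_at a z) (eval_at a w)"
  "eval_at a (nf_x (\<lambda>i. cst (g i)) x y z w) = nf_x g (eval_at a x) (eval_at a y) (eval_at a z) (eval_at a w)"
  "eval_at a (nf_y (\<lambda>i. cst (g i)) x y z w) = nf_y g (eval_at a x) (eval_at a y) (eval_at a z) (eval_at a w)"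
  "eval_at a (nf_z (\<lambda>i. cst (g i)) x y z w) = nf_z g (eval_at a x) (eval_at a y) (eval_at a z) (eval_at a w)"
  "eval_at a (nf_w (\<lambda>i. cst (g i)) x y z w) = nf_w g (eval_at a x) (eval_at a y) (eval_at a z) (eval_at a w)"
  "eval_at a (nf_det (\<lambda>i. cst (g i)) x y z) = nf_det g (eval_at a x) (eval_at a y) (eval_at a z)"
  by (simp_all add: nf_defs nf_det_def)

lemma partial_nf:
  "partial m (nf (\<lambda>i. cst (g i)) x y z w) =
     nf_x (\<lambda>i. cst (g i)) x y z w * partial m x + nf_y (\<lambda>i. cst (g i)) x y z w * partial m y
     + nf_z (\<lambda>i. cst (g i)) x y z w * partial m z + nf_w (\<lambda>i. cst (g i)) x y z w * partial m w"
  unfolding nf_defs by (simp add: eval_nat_numeral algebra_simps)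

section \<open>Comparison of coefficients\<close>

lemma degree_14_coeffs_eq_0:
  fixes c1 c2 c3 c4 c5 c6 c7 c8 c9 c10 c11 c12 c13 :: complex
  assumes "\<And>x y z w. c1 * x^7 + c2 * x^5 * z + c3 * x^3 * z^2 + c4 * x * z^3 + c5 * x^4 * y^2
     + c6 * x^2 * y^2 * z + c7 * y^2 * z^2 + c8 * x * y^4 + c9 * x^3 * y * w + c10 * x * y * z * w
     + c11 * y^3 * w + c12 * x^2 * w^2 + c13 * z * w^2 = 0"
  shows "c1 = 0" "c2 = 0" "c3 = 0" "c4 = 0" "c5 = 0" "c6 = 0" "c7 = 0" "c8 = 0" "c9 = 0" "c10 = 0"
    "c11 = 0" "c12 = 0" "c13 = 0"
proof -
  \<comment> \<open>the 13 monomials have distinct exponents after \<open>x = 1\<close>, \<open>z = t\<close>, \<open>y = t^4\<close>, \<open>w = t^20\<close>\<close>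
  let ?p = "Polynomial.monom c1 0 + Polynomial.monom c2 1 + Polynomial.monom c3 2
    + Polynomial.monom c4 3 + Polynomial.monom c5 8 + Polynomial.monom c6 9
    + Polynomial.monom c7 10 + Polynomial.monom c8 16 + Polynomial.monom c9 24
    + Polynomial.monom c10 25 + Polynomial.monom c11 32 + Polynomial.monom c12 40
    + Polynomial.monom c13 41"
  have "poly ?p t = 0" for t
  proof -
    have "poly ?p t = c1 * 1^7 + c2 * 1^5 * t + c3 * 1^3 * t^2 + c4 * 1 * t^3 + c5 * 1^4 * (t^4)^2
     + c6 * 1^2 * (t^4)^2 * t + c7 * (t^4)^2 * t^2 + c8 * 1 * (t^4)^4 + c9 * 1^3 * t^4 * t^20
     + c10 * 1 * t^4 * t * t^20 + c11 * (t^4)^3 * t^20 + c12 * 1^2 * (t^20)^2 + c13 * t * (t^20)^2"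
      by (simp add: poly_monom eval_nat_numeral mult_ac)
    also have "\<dots> = 0" by (rule assms)
    finally show ?thesis .
  qed
  then have "?p = 0" using poly_all_0_iff_0 by blast
  then have "Polynomial.coeff ?p k = 0" for k by simp
  from this[of 0] this[of 1] this[of 2] this[of 3] this[of 8] this[of 9] this[of 10] this[of 16]
    this[of 24] this[of 25] this[of 32] this[of 40] this[of 41]
  show "c1 = 0" "c2 = 0" "c3 = 0" "c4 = 0" "c5 = 0" "c6 = 0" "c7 = 0" "c8 = 0" "c9 = 0" "c10 = 0"
    "c11 = 0" "c12 = 0" "c13 = 0"
    by simp_all
qed

text \<open>The left side is the general vector field of weight 0 applied to the normal form. Its
  coefficients satisfy a linear system, one equation per monomial, which successively forces ratios
  between \<beta>, \<gamma>, \<delta> and \<open>c\<close> until a coefficient required by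
  \<open>g\<close> has to vanish.\<close>

lemma nf_det_not_infinitesimally_trivial:
  fixes g :: "nat \<Rightarrow> complex"
  assumes g: "g 0 \<noteq> 0" "g 6 \<noteq> 0" "g 1 \<noteq> 0 \<or> g 10 \<noteq> 0" "g 3 \<noteq> 0 \<or> g 4 \<noteq> 0"
    and eq: "\<And>x y z w. c * x * nf_x g x y z w + \<gamma> * y * nf_y g x y z w
      + (\<beta> * z + \<alpha> * x^2) * nf_z g x y z w + (\<delta> * w + \<epsilon> * x * y) * nf_w g x y z w
      = x * nf_det g x y z"
  shows False
proof -
  have *: "(7 * c * g 3 + \<alpha> * g 4 - g 2 ^ 2) * x^7
     + ((5 * c + \<beta>) * g 4 + 2 * \<alpha> * g 5 + 4 * g 0 * g 7) * x^5 * z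
     + ((3 * c + 2 * \<beta>) * g 5 + 3 * \<alpha> * g 6 + 4 * g 0 * g 8) * x^3 * z^2
     + ((c + 3 * \<beta>) * g 6 + 4 * g 0 * g 9) * x * z^3
     + ((4 * c + 2 * \<gamma>) * g 7 + \<alpha> * g 8 + \<epsilon> * g 2 - 4 * g 1 * g 2) * x^4 * y^2
     + ((2 * c + 2 * \<gamma> + \<beta>) * g 8 + 2 * \<alpha> * g 9 + 8 * g 0 * g 10) * x^2 * y^2 * z
     + ((2 * \<gamma> + 2 * \<beta>) * g 9) * y^2 * z^2
     + ((c + 4 * \<gamma>) * g 10 + \<epsilon> * g 1 - 3 * g 1 ^ 2) * x * y^4
     + ((3 * c + \<gamma> + \<delta>) * g 2) * x^3 * y * w
     + (2 * \<epsilon> * g 0) * x * y * z * w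
     + ((3 * \<gamma> + \<delta>) * g 1) * y^3 * w
     + (\<alpha> * g 0) * x^2 * w^2
     + ((\<beta> + 2 * \<delta>) * g 0) * z * w^2 = 0" for x y z w
    using eq[of x y z w] unfolding nf_defs nf_det_def by (simp add: algebra_simps eval_nat_numeral)
  note E = degree_14_coeffs_eq_0[OF *]
  have [simp]: "\<alpha> = 0" "\<epsilon> = 0" using E g by simp_all
  have \<beta>: "\<beta> = - 2 * \<delta>" using E(13) g by (simp add: eq_neg_iff_add_eq_0)
  show False
  proof (cases "g 1 = 0")
    case False
    then have \<delta>: "\<delta> = - 3 * \<gamma>" using E(11) by (simp add: eq_neg_iff_add_eq_0 add.commute)
    show False
    proof (cases "\<gamma> = 0")
      case True
      \<comment> \<open>Now \<beta> and \<delta> vanish as well. The coefficient of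
        \<open>x * y^4\<close> gives \<open>c * g 10 = 3 * g 1 ^ 2\<close>, so \<open>c\<close> is
        nonzero; then \<open>E(9)\<close>, \<open>E(5)\<close>, \<open>E(1)\<close> and
        \<open>E(2)\<close> annihilate \<open>g 2\<close>, \<open>g 7\<close>, \<open>g 3\<close>
        and \<open>g 4\<close>, against the last assumption on \<open>g\<close>.\<close>
      with E \<beta> \<delta> False g show False by auto
    next
      case \<gamma>: False
      then have "g 9 = 0" using E(7) by (simp add: \<beta> \<delta>)
      then have c: "c = - 18 * \<gamma>" using E(4) g(2) by (simp add: \<beta> \<delta> eq_neg_iff_add_eq_0)
      have "g 2 = 0" using E(9) \<gamma> by (simp add: c \<delta>)
      then have "g 7 = 0" using E(5) \<gamma> by (simp add: c)
      then have "g 4 = 0" using E(2) \<gamma> by (simp add: c \<beta> \<delta>)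
      moreover have "g 3 = 0" using E(1) \<gamma> \<open>g 2 = 0\<close> by (simp add: c)
      ultimately show False using g by simp
    qed
  next
    case True
    then have g10: "g 10 \<noteq> 0" using g by simp
    then have c: "c = - 4 * \<gamma>" using E(8) True by (simp add: eq_neg_iff_add_eq_0)
    have \<gamma>: "\<gamma> \<noteq> 0"
    proof
      assume "\<gamma> = 0"
      \<comment> \<open>With \<open>c\<close> and \<gamma> zero, \<open>E(6)\<close> reads
        \<open>\<beta> * g 8 = - 8 * g 0 * g 10\<close>, so \<beta> is nonzero; then
        \<open>E(7)\<close> gives \<open>g 9 = 0\<close> and \<open>E(4)\<close> gives
        \<open>g 6 = 0\<close>.\<close>
      with E g g10 c show False by auto
    qed
    have "g 7 = 0" using E(5) \<gamma> True by (simp add: c)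
    \<comment> \<open>The two ratios are those forced by \<open>g 2 \<noteq> 0\<close> (through
      \<open>E(9)\<close> and \<open>\<beta> = - 2 * \<delta>\<close>) and by
      \<open>g 4 \<noteq> 0\<close> (through \<open>E(2)\<close>). Either would make
      \<open>g 9\<close>, and then \<open>g 6\<close>, vanish.\<close>
    have \<beta>_ratio: "\<beta> \<noteq> k * \<gamma>" if "k = - 22 \<or> k = 20" for k
    proof
      assume b: "\<beta> = k * \<gamma>"
      then have "g 9 = 0" using E(7) that \<gamma> by auto
      then show False using E(4) g(2) b that \<gamma> by (auto simp: c)
    qed
    have "g 2 = 0"
    proof (rule ccontr)
      assume "g 2 \<noteq> 0"
      then have "\<delta> = 11 * \<gamma>" using E(9) by (simp add: c)
      then show False using \<beta>_ratio[of "- 22"] \<beta> by simp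
    qed
    then have "g 3 = 0" using E(1) \<gamma> by (simp add: c)
    then have "5 * c + \<beta> = 0" using E(2) g \<open>g 7 = 0\<close> by simp
    then show False using \<beta>_ratio[of 20] by (simp add: c)
  qed
qed

section \<open>Homogeneous polynomials\<close>

lemma homogeneous_polys_add:
  "p \<in> homogeneous_polys n w k \<Longrightarrow> q \<in> homogeneous_polys n w k \<Longrightarrow> p + q \<in> homogeneous_polys n w k"
  using Poly_Mapping.keys_add[of p q] by (auto simp: homogeneous_polys_def intro: polys_add)

lemma homogeneous_polys_mult:
  assumes "p \<in> homogeneous_polys n w k" "q \<in> homogeneous_polys n w l" "k + l = e"
  shows "p * q \<in> homogeneous_polys n w e"
proof -
  have "int (weighted_deg w m) = e" if "m \<in> keys (p * q)" for m
  proof -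
    obtain m1 m2 where "m1 \<in> keys p" "m2 \<in> keys q" "m = m1 + m2"
      using \<open>m \<in> keys (p * q)\<close> Poly_Mapping.keys_mult[of p q] by blast
    then show ?thesis using assms by (auto simp: homogeneous_polys_def weighted_deg_add)
  qed
  then show ?thesis using assms by (simp add: homogeneous_polys_def polys_mult)
qed

lemma homogeneous_polys_cst: "cst c \<in> homogeneous_polys n w 0"
  using polys_cst[of c n] by (auto simp: homogeneous_polys_def cst_def)

lemma homogeneous_polys_numeral: "numeral c \<in> homogeneous_polys n w 0"
  using homogeneous_polys_cst[of "numeral c"] by simp

lemma homogeneous_polys_uminus:
  "p \<in> homogeneous_polys n w k \<Longrightarrow> - p \<in> homogeneous_polys n w k"
  using homogeneous_polys_mult[OF homogeneous_polys_cst[of "- 1" n w], of p k k] by (simp add: cst_minus)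

lemma homogeneous_polys_diff:
  "p \<in> homogeneous_polys n w k \<Longrightarrow> q \<in> homogeneous_polys n w k \<Longrightarrow> p - q \<in> homogeneous_polys n w k"
  using homogeneous_polys_add[OF _ homogeneous_polys_uminus, of p n w k q] by simp

lemma homogeneous_polys_var: "i < n \<Longrightarrow> var i \<in> homogeneous_polys n w (int (w i))"
  using weighted_deg_single[of w i 1] polys_var[of i n] by (auto simp: homogeneous_polys_def var_def)

lemma homogeneous_polys_0: "0 \<in> homogeneous_polys n w k"
  by (auto simp: homogeneous_polys_def polys_0)

lemma homogeneous_polys_power:
  "p \<in> homogeneous_polys n w k \<Longrightarrow> int e * k = l \<Longrightarrow> p ^ e \<in> homogeneous_polys n w l"
proof (induction e arbitrary: l)
  case 0
  then show ?case using homogeneous_polys_cst[of 1 n w] by simp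
next
  case (Suc e)
  then show ?case
    by (auto intro!: homogeneous_polys_mult[where k = k and l = "int e * k"] simp: algebra_simps)
qed

lemma homogeneous_polys_sum:
  "(\<And>i. i \<in> A \<Longrightarrow> h i \<in> homogeneous_polys n w k) \<Longrightarrow> sum h A \<in> homogeneous_polys n w k"
  by (induction A rule: infinite_finite_induct)
    (auto intro: homogeneous_polys_0 homogeneous_polys_add)

lemma restrict_keys_True: "restrict_keys (\<lambda>_. True) p = p"
  by (rule poly_mapping_eqI) (simp add: lookup_restrict_keys)

text \<open>The zero polynomial is a separate case because a degree, for instance a negative one,
  may contain no monomial at all.\<close>

lemma homogeneous_polys_induct [consumes 1, case_names single zero add]:
  assumes p: "p \<in> homogeneous_polys n w k"
    and single: "\<And>m c. keys m \<subseteq> {..<n} \<Longrightarrow> int (weighted_deg w m) = k \<Longrightarrow> P (single m c)"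
    and zero: "P 0" and add: "\<And>p q. P p \<Longrightarrow> P q \<Longrightarrow> P (p + q)"
  shows "P p"
proof -
  have "P (\<Sum>m\<in>A. single m (lookup p m))" if "finite A" "A \<subseteq> keys p" for A
    using that
    by (induction A rule: finite_induct)
      (use p in \<open>auto simp: homogeneous_polys_def polys_def intro!: zero add single\<close>)
  moreover have "(\<Sum>m\<in>keys p. single m (lookup p m)) = p"
    using restrict_keys_def[of "\<lambda>_. True" p] by (simp add: restrict_keys_True)
  ultimately show ?thesis by (metis finite_keys order_refl)
qed

lemma eval_at_act:
  assumes "f \<in> homogeneous_polys n w (int d)"
  shows "eval_at (act w t a) f = t ^ d * eval_at a f"
  using assms
proof (induction rule: homogeneous_polys_induct)
  case (single m c)
  have "eval_mono (act w t a) m = t ^ weighted_deg w m * eval_mono a m"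
    by (simp add: eval_mono_def act_def weighted_deg_def power_sum power_mult power_mult_distrib
        prod.distrib)
  then show ?case using single by (simp add: eval_at_single)
qed (simp_all add: algebra_simps)

lemma eval_at_affine_space_extend:
  assumes "f \<in> polys n"
  shows "eval_at (a(n := c)) f = eval_at a f"
proof -
  have "eval_mono (a(n := c)) m = eval_mono a m" if "m \<in> keys f" for m
    unfolding eval_mono_def by (rule prod.cong) (use that assms in \<open>auto simp: polys_def\<close>)
  then show ?thesis by (simp add: eval_at_eval_mono)
qed

section \<open>Monomials of low degree for the weights 2, 3, 4, 5, 7, \<dots>, 7\<close>

lemma gm_weight_simps [simp]:
  "gm_weight 0 = 2" "gm_weight (Suc 0) = 3" "gm_weight 2 = 4" "gm_weight 3 = 5" "gm_weight (4 + i) = 7"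
  by (simp_all add: gm_weight_def)

lemma sum_gm_weight: "(\<Sum>i<4 + j. gm_weight i) = 14 + 7 * j"
proof (induction j)
  case 0
  show ?case by (simp add: eval_nat_numeral lessThan_Suc) (simp add: gm_weight_def)
next
  case (Suc j)
  have "{..<4 + Suc j} = insert (4 + j) {..<4 + j}" by auto
  then show ?case using Suc by simp
qed

lemma single_add_eq_mult: "single (m + m') c = single m 1 * single m' (c::complex)"
  by (simp add: mult_single)

lemma single_single_eq_var_power: "single (single i k) 1 = var i ^ k"
proof (induction k)
  case (Suc k)
  have "single (single i (Suc k)) (1::complex) = single (single i 1 + single i k) 1"
    by (simp add: single_add[symmetric] del: single_add)
  then show ?case using Suc by (simp add: single_add_eq_mult var_def)
qed simp

lemma gm_mono4:
  assumes "keys m \<subseteq> {..<4}"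
  shows "single m c = cst c * var 0 ^ lookup m 0 * var 1 ^ lookup m 1 * var 2 ^ lookup m 2 * var 3 ^ lookup m 3"
    and "weighted_deg gm_weight m = 2 * lookup m 0 + 3 * lookup m 1 + 4 * lookup m 2 + 5 * lookup m 3"
proof -
  have m: "m = single 0 (lookup m 0) + (single 1 (lookup m 1) + (single 2 (lookup m 2) + (single 3 (lookup m 3) + 0)))"
  proof (rule poly_mapping_eqI)
    fix k
    have "k < 4 \<or> lookup m k = 0" using assms unfolding subset_iff in_keys_iff by auto
    then show "lookup m k = lookup (single 0 (lookup m 0) + (single 1 (lookup m 1) + (single 2 (lookup m 2) + (single 3 (lookup m 3) + 0)))) k"
      by (auto simp: lookup_add lookup_single when_def less_Suc_eq eval_nat_numeral)
  qed
  show "single m c = cst c * var 0 ^ lookup m 0 * var 1 ^ lookup m 1 * var 2 ^ lookup m 2 * var 3 ^ lookup m 3"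
    by (subst m) (simp only: single_add_eq_mult single_single_eq_var_power cst_def mult_ac)
  show "weighted_deg gm_weight m = 2 * lookup m 0 + 3 * lookup m 1 + 4 * lookup m 2 + 5 * lookup m 3"
    by (subst m) (simp add: weighted_deg_add)
qed

lemma split_off_var:
  assumes "i \<in> keys m"
  obtains m' where "m = single i 1 + m'" "keys m' \<subseteq> keys m" "\<And>c. single m c = var i * single m' c"
    "weighted_deg w m = w i + weighted_deg w m'"
proof -
  let ?m' = "m - single i 1"
  have m: "m = single i 1 + ?m'"
    using assms by (intro poly_mapping_eqI) (auto simp: lookup_add lookup_minus lookup_single when_def in_keys_iff)
  moreover have "keys ?m' \<subseteq> keys m"
    unfolding subset_iff in_keys_iff lookup_minus by (metis diff_0_eq_0)
  moreover have "single m c = var i * single ?m' c" for c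
    by (subst m) (simp only: single_add_eq_mult var_def)
  moreover have "weighted_deg w m = w i + weighted_deg w ?m'"
    by (subst m) (simp add: weighted_deg_add)
  ultimately show thesis using that by blast
qed

lemma gm_weight_pos: "gm_weight i > 0"
proof -
  consider "i = 0" | "i = 1" | "i = 2" | "i = 3" | "i \<ge> 4" by linarith
  then show ?thesis by cases (simp_all add: gm_weight_def)
qed

lemma gm_degree_0:
  assumes "weighted_deg gm_weight m = 0" shows "m = 0"
proof (rule poly_mapping_eqI)
  fix i
  have "gm_weight i * lookup m i = 0" if "i \<in> keys m"
    using assms that unfolding weighted_deg_def by (simp add: sum_eq_0_iff)
  then show "lookup m i = lookup 0 i"
    using gm_weight_pos[of i] by (cases "i \<in> keys m") (simp_all add: in_keys_iff)
qed

text \<open>Splitting off a variable of weight 7 lowers the degree by 7. Below degree 7 only the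
  four small variables can occur, and in degree 14 the cofactor has degree 7.\<close>

lemma gm_keys_cases:
  assumes "keys m \<subseteq> {..<4 + j}"
  obtains "keys m \<subseteq> {..<4}"
  | i m' where "i < j" "keys m' \<subseteq> {..<4 + j}" "\<And>c. single m c = var (4 + i) * single m' c"
      "weighted_deg gm_weight m = 7 + weighted_deg gm_weight m'"
proof (cases "keys m \<subseteq> {..<4}")
  case False
  then obtain k where k: "k \<in> keys m" "\<not> k < 4" by auto
  define i where "i = k - 4"
  have i: "k = 4 + i" "i < j" using k assms by (auto simp: i_def)
  obtain m' where m': "keys m' \<subseteq> keys m" "\<And>c. single m c = var k * single m' c"
    "weighted_deg gm_weight m = gm_weight k + weighted_deg gm_weight m'"
    by (rule split_off_var[OF k(1), where w = gm_weight]) blast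
  show thesis
  proof (rule that(2))
    show "i < j" by (rule i)
    show "keys m' \<subseteq> {..<4 + j}" using m'(1) assms by blast
    show "single m c = var (4 + i) * single m' c" for c using m'(2) unfolding i .
    show "weighted_deg gm_weight m = 7 + weighted_deg gm_weight m'" using m'(3) unfolding i gm_weight_simps .
  qed
qed (use that in blast)

text \<open>Each exponent is bounded by degree over weight, which leaves a finite search. Degrees 2
  to 5 serve for the components of a vector field, 7 for the cofactor of a weight-7 variable, 14 for
  the hypersurface itself.\<close>

lemma gm_exponents:
  fixes a b c e :: nat
  shows "2 * a + 3 * b + 4 * c + 5 * e = 2 \<Longrightarrow> (a, b, c, e) \<in> {(1,0,0,0)}"
    and "2 * a + 3 * b + 4 * c + 5 * e = 3 \<Longrightarrow> (a, b, c, e) \<in> {(0,1,0,0)}"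
    and "2 * a + 3 * b + 4 * c + 5 * e = 4 \<Longrightarrow> (a, b, c, e) \<in> {(0,0,1,0), (2,0,0,0)}"
    and "2 * a + 3 * b + 4 * c + 5 * e = 5 \<Longrightarrow> (a, b, c, e) \<in> {(0,0,0,1), (1,1,0,0)}"
    and "2 * a + 3 * b + 4 * c + 5 * e = 7 \<Longrightarrow> (a, b, c, e) \<in> {(0,1,1,0), (1,0,0,1), (2,1,0,0)}"
    and "2 * a + 3 * b + 4 * c + 5 * e = 14 \<Longrightarrow> (a, b, c, e) \<in> {(0,0,1,2), (0,2,2,0), (0,3,0,1), (1,0,3,0), (1,1,1,1), (1,4,0,0), (2,0,0,2), (2,2,1,0), (3,0,2,0), (3,1,0,1), (4,2,0,0), (5,0,1,0), (7,0,0,0)}"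
proof -
  show "(a, b, c, e) \<in> {(1,0,0,0)}" if "2 * a + 3 * b + 4 * c + 5 * e = 2"
  proof -
    have "e = 0" "c = 0" "b = 0"
      "a = 0 \<or> a = 1"
      using that by linarith+
    with that show ?thesis by auto
  qed
  show "(a, b, c, e) \<in> {(0,1,0,0)}" if "2 * a + 3 * b + 4 * c + 5 * e = 3"
  proof -
    have "e = 0" "c = 0" "b = 0 \<or> b = 1"
      "a = 0 \<or> a = 1"
      using that by linarith+
    with that show ?thesis by (elim disjE) simp_all
  qed
  show "(a, b, c, e) \<in> {(0,0,1,0), (2,0,0,0)}" if "2 * a + 3 * b + 4 * c + 5 * e = 4"
  proof -
    have "e = 0" "c = 0 \<or> c = 1" "b = 0 \<or> b = 1"
      "a = 0 \<or> a = 1 \<or> a = 2"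
      using that by linarith+
    with that show ?thesis by (elim disjE) simp_all
  qed
  show "(a, b, c, e) \<in> {(0,0,0,1), (1,1,0,0)}" if "2 * a + 3 * b + 4 * c + 5 * e = 5"
  proof -
    have "e = 0 \<or> e = 1" "c = 0 \<or> c = 1" "b = 0 \<or> b = 1"
      "a = 0 \<or> a = 1 \<or> a = 2"
      using that by linarith+
    with that show ?thesis by (elim disjE) simp_all
  qed
  show "(a, b, c, e) \<in> {(0,1,1,0), (1,0,0,1), (2,1,0,0)}" if "2 * a + 3 * b + 4 * c + 5 * e = 7"
  proof -
    have "e = 0 \<or> e = 1" "c = 0 \<or> c = 1" "b = 0 \<or> b = 1 \<or> b = 2"
      "a = 0 \<or> a = 1 \<or> a = 2 \<or> a = 3"
      using that by linarith+
    with that show ?thesis by (elim disjE) simp_all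
  qed
  show "(a, b, c, e) \<in> {(0,0,1,2), (0,2,2,0), (0,3,0,1), (1,0,3,0), (1,1,1,1), (1,4,0,0), (2,0,0,2), (2,2,1,0), (3,0,2,0), (3,1,0,1), (4,2,0,0), (5,0,1,0), (7,0,0,0)}" if "2 * a + 3 * b + 4 * c + 5 * e = 14"
  proof -
    have "e = 0 \<or> e = 1 \<or> e = 2" "c = 0 \<or> c = 1 \<or> c = 2 \<or> c = 3" "b = 0 \<or> b = 1 \<or> b = 2 \<or> b = 3 \<or> b = 4"
      "a = 0 \<or> a = 1 \<or> a = 2 \<or> a = 3 \<or> a = 4 \<or> a = 5 \<or> a = 6 \<or> a = 7"
      using that by linarith+
    with that show ?thesis by (elim disjE) simp_all
  qed
qed

text \<open>This and the next three lemmas determine the components of a vector field of weight 0: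
  the component along a variable has the weight of that variable.\<close>

lemma gm_degree_2:
  assumes "p \<in> homogeneous_polys (4 + j) gm_weight 2"
  obtains c where "p = cst c * var 0"
proof -
  from assms have "\<exists>c. p = cst c * var 0"
  proof (induction rule: homogeneous_polys_induct)
    case (single m c)
    from single(1) show ?case
    proof (cases rule: gm_keys_cases)
      case 1
      have "lookup m 0 = 1 \<and> lookup m 1 = 0 \<and> lookup m 2 = 0 \<and> lookup m 3 = 0"
        using gm_exponents(1)[of "lookup m 0" "lookup m 1" "lookup m 2" "lookup m 3"]
        single(2) gm_mono4(2)[OF 1] by auto
      then show ?thesis using gm_mono4(1)[OF 1, of c] by auto
    qed (use single(2) in simp)
  next
    case zero
    show ?case by (rule exI[of _ 0]) simp
  next
    case (add p q)
    then show ?case by (metis cst_add distrib_right)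
  qed
  then show thesis using that by blast
qed

lemma gm_degree_3:
  assumes "p \<in> homogeneous_polys (4 + j) gm_weight 3"
  obtains c where "p = cst c * var 1"
proof -
  from assms have "\<exists>c. p = cst c * var 1"
  proof (induction rule: homogeneous_polys_induct)
    case (single m c)
    from single(1) show ?case
    proof (cases rule: gm_keys_cases)
      case 1
      have "lookup m 0 = 0 \<and> lookup m 1 = 1 \<and> lookup m 2 = 0 \<and> lookup m 3 = 0"
        using gm_exponents(2)[of "lookup m 0" "lookup m 1" "lookup m 2" "lookup m 3"]
        single(2) gm_mono4(2)[OF 1] by auto
      then show ?thesis using gm_mono4(1)[OF 1, of c] by auto
    qed (use single(2) in simp)
  next
    case zero
    show ?case by (rule exI[of _ 0]) simp
  next
    case (add p q)
    then show ?case by (metis cst_add distrib_right)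
  qed
  then show thesis using that by blast
qed

lemma gm_degree_4:
  assumes "p \<in> homogeneous_polys (4 + j) gm_weight 4"
  obtains c c' where "p = cst c * var 0 ^ 2 + cst c' * var 2"
proof -
  from assms have "\<exists>c c'. p = cst c * var 0 ^ 2 + cst c' * var 2"
  proof (induction rule: homogeneous_polys_induct)
    case (single m c)
    from single(1) show ?case
    proof (cases rule: gm_keys_cases)
      case 1
      have "(lookup m 0 = 2 \<and> lookup m 1 = 0 \<and> lookup m 2 = 0 \<and> lookup m 3 = 0)
          \<or> (lookup m 0 = 0 \<and> lookup m 1 = 0 \<and> lookup m 2 = 1 \<and> lookup m 3 = 0)"
        using gm_exponents(3)[of "lookup m 0" "lookup m 1" "lookup m 2" "lookup m 3"]
        single(2) gm_mono4(2)[OF 1] by auto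
      then have "single m c = cst c * var 0 ^ 2 + cst 0 * var 2
          \<or> single m c = cst 0 * var 0 ^ 2 + cst c * var 2"
        using gm_mono4(1)[OF 1, of c] by auto
      then show ?thesis by blast
    qed (use single(2) in simp)
  next
    case zero
    have "0 = cst 0 * var 0 ^ 2 + cst 0 * var 2" by simp
    then show ?case by blast
  next
    case (add p q)
    then obtain c c' d d' where "p = cst c * var 0 ^ 2 + cst c' * var 2"
      "q = cst d * var 0 ^ 2 + cst d' * var 2" by blast
    then have "p + q = cst (c + d) * var 0 ^ 2 + cst (c' + d') * var 2"
      by (simp add: cst_add algebra_simps)
    then show ?case by blast
  qed
  then show thesis using that by blast
qed

lemma gm_degree_5:
  assumes "p \<in> homogeneous_polys (4 + j) gm_weight 5"
  obtains c c' where "p = cst c * var 0 * var 1 + cst c' * var 3"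
proof -
  from assms have "\<exists>c c'. p = cst c * var 0 * var 1 + cst c' * var 3"
  proof (induction rule: homogeneous_polys_induct)
    case (single m c)
    from single(1) show ?case
    proof (cases rule: gm_keys_cases)
      case 1
      have "(lookup m 0 = 1 \<and> lookup m 1 = 1 \<and> lookup m 2 = 0 \<and> lookup m 3 = 0)
          \<or> (lookup m 0 = 0 \<and> lookup m 1 = 0 \<and> lookup m 2 = 0 \<and> lookup m 3 = 1)"
        using gm_exponents(4)[of "lookup m 0" "lookup m 1" "lookup m 2" "lookup m 3"]
        single(2) gm_mono4(2)[OF 1] by auto
      then have "single m c = cst c * var 0 * var 1 + cst 0 * var 3
          \<or> single m c = cst 0 * var 0 * var 1 + cst c * var 3"
        using gm_mono4(1)[OF 1, of c] by auto
      then show ?thesis by blast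
    qed (use single(2) in simp)
  next
    case zero
    have "0 = cst 0 * var 0 * var 1 + cst 0 * var 3" by simp
    then show ?case by blast
  next
    case (add p q)
    then obtain c c' d d' where "p = cst c * var 0 * var 1 + cst c' * var 3"
      "q = cst d * var 0 * var 1 + cst d' * var 3" by blast
    then have "p + q = cst (c + d) * var 0 * var 1 + cst (c' + d') * var 3"
      by (simp add: cst_add algebra_simps)
    then show ?case by blast
  qed
  then show thesis using that by blast
qed

lemma gm_mono_degree_7:
  assumes "keys m \<subseteq> {..<4 + j}" "weighted_deg gm_weight m = 7"
  shows "(\<exists>k<j. single m c = cst c * var (4 + k)) \<or> single m c = cst c * (var 0 * var 3)
    \<or> single m c = cst c * (var 1 * var 2) \<or> single m c = cst c * (var 0 ^ 2 * var 1)"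
  using assms(1)
proof (cases rule: gm_keys_cases)
  case 1
  have "(lookup m 0 = 1 \<and> lookup m 1 = 0 \<and> lookup m 2 = 0 \<and> lookup m 3 = 1)
      \<or> (lookup m 0 = 0 \<and> lookup m 1 = 1 \<and> lookup m 2 = 1 \<and> lookup m 3 = 0)
      \<or> (lookup m 0 = 2 \<and> lookup m 1 = 1 \<and> lookup m 2 = 0 \<and> lookup m 3 = 0)"
    using gm_exponents(5)[of "lookup m 0" "lookup m 1" "lookup m 2" "lookup m 3"]
        assms(2) gm_mono4(2)[OF 1] by auto
  then show ?thesis using gm_mono4(1)[OF 1, of c] by (auto simp: mult.assoc)
next
  case (2 i m')
  then have "m' = 0" using assms(2) by (intro gm_degree_0) simp
  then have "single m c = cst c * var (4 + i)" using 2(3)[of c] by (simp add: cst_def mult.commute)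
  then show ?thesis using 2(1) by blast
qed

section \<open>The normal form of a quasi-smooth member\<close>

text \<open>The general form of degree 7 in the four small variables. It occurs both as the
  coefficient of a weight-7 variable and as the shift that completes the square.\<close>

definition odd_form :: "(nat \<Rightarrow> complex) \<Rightarrow> (nat \<Rightarrow> complex) \<Rightarrow> (nat \<Rightarrow> complex) \<Rightarrow> nat \<Rightarrow> cpoly" where
  "odd_form p q r i = cst (p i) * (var 0 * var 3) + cst (q i) * (var 1 * var 2)
     + cst (r i) * (var 0 ^ 2 * var 1)"

text \<open>The general polynomial of degree 14, sorted by degree in the weight-7 variables; \<rho>
  and \<sigma> belong to the two monomials absent from \<open>nf\<close>. Symmetry of
  \<open>s\<close> is not imposed, so the parameters are not unique.\<close>

definition gm_general :: "nat \<Rightarrow> (nat \<Rightarrow> complex) \<Rightarrow> complex \<Rightarrow> complex \<Rightarrow> (nat \<Rightarrow> complex) \<Rightarrow>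
    (nat \<Rightarrow> complex) \<Rightarrow> (nat \<Rightarrow> complex) \<Rightarrow> (nat \<Rightarrow> nat \<Rightarrow> complex) \<Rightarrow> cpoly" where
  "gm_general j g \<rho> \<sigma> p q r s =
     nf (\<lambda>i. cst (g i)) (var 0) (var 1) (var 2) (var 3)
     + cst \<rho> * (var 0 ^ 2 * var 3 ^ 2) + cst \<sigma> * (var 0 * var 1 * var 2 * var 3)
     + (\<Sum>i<j. var (4 + i) * odd_form p q r i)
     + (\<Sum>i<j. \<Sum>k<j. cst (s i k) * (var (4 + i) * var (4 + k)))"

lemma gm_general_add:
  "gm_general j g \<rho> \<sigma> p q r s + gm_general j g' \<rho>' \<sigma>' p' q' r' s'
     = gm_general j (\<lambda>i. g i + g' i) (\<rho> + \<rho>') (\<sigma> + \<sigma>') (\<lambda>i. p i + p' i) (\<lambda>i. q i + q' i)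
         (\<lambda>i. r i + r' i) (\<lambda>i k. s i k + s' i k)"
  by (simp add: gm_general_def nf_def odd_form_def cst_add ring_distribs sum.distrib)

lemma sum_single_index:
  fixes h :: "nat \<Rightarrow> 'a::comm_monoid_add"
  assumes "i < j" "\<And>k. k < j \<Longrightarrow> k \<noteq> i \<Longrightarrow> h k = 0"
  shows "(\<Sum>k<j. h k) = h i"
proof -
  have "(\<Sum>k<j. h k) = (\<Sum>k<j. if k = i then h i else 0)"
    by (rule sum.cong) (use assms in auto)
  then show ?thesis using assms by simp
qed

lemma gm_general_exists:
  assumes "f \<in> homogeneous_polys (4 + j) gm_weight 14"
  obtains g \<rho> \<sigma> p q r s where "f = gm_general j g \<rho> \<sigma> p q r s"
proof -
  let ?G = "\<lambda>f. \<exists>g \<rho> \<sigma> p q r s. f = gm_general j g \<rho> \<sigma> p q r s"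
  let ?o = "\<lambda>_. 0 :: complex"
  have GI: "?G f" if "f = gm_general j g \<rho> \<sigma> p q r s" for f g \<rho> \<sigma> p q r s
    using that by blast
  from assms have "?G f"
  proof (induction rule: homogeneous_polys_induct)
    case (single m c)
    have wd: "weighted_deg gm_weight m = 14" using single(2) by simp
    from single(1) show ?case
    proof (cases rule: gm_keys_cases)
      case 1
      have nf: "?G (nf (\<lambda>i. cst (g i)) (var 0) (var 1) (var 2) (var 3))" for g
        by (rule GI[of _ g 0 0 ?o ?o ?o "\<lambda>_. ?o"]) (simp add: gm_general_def odd_form_def)
      have \<rho>: "?G (cst c * (var 0 ^ 2 * var 3 ^ 2))"
        by (rule GI[of _ ?o c 0 ?o ?o ?o "\<lambda>_. ?o"]) (simp add: gm_general_def odd_form_def nf_def)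
      have \<sigma>: "?G (cst c * (var 0 * var 1 * var 2 * var 3))"
        by (rule GI[of _ ?o 0 c ?o ?o ?o "\<lambda>_. ?o"]) (simp add: gm_general_def odd_form_def nf_def)
      have m: "single m c = cst c * var 0 ^ a * var 1 ^ b * var 2 ^ d * var 3 ^ e"
        if "(lookup m 0, lookup m 1, lookup m 2, lookup m 3) = (a, b, d, e)" for a b d e
        using gm_mono4(1)[OF 1, of c] that by simp
      let ?t = "(lookup m 0, lookup m 1, lookup m 2, lookup m 3)"
      from gm_exponents(6)[of "lookup m 0" "lookup m 1" "lookup m 2" "lookup m 3"]
      have "?t \<in> {(0,0,1,2), (0,2,2,0), (0,3,0,1), (1,0,3,0), (1,1,1,1), (1,4,0,0), (2,0,0,2), (2,2,1,0), (3,0,2,0), (3,1,0,1), (4,2,0,0), (5,0,1,0), (7,0,0,0)}"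
        using gm_mono4(2)[OF 1] wd by simp
      then show ?thesis unfolding insert_iff empty_iff
      proof (elim disjE FalseE)
        assume "?t = (0,0,1,2)"
        then show ?thesis using m[of 0 0 1 2] nf[of "?o(0 := c)"] by (simp add: nf_def)
      next
        assume "?t = (0,2,2,0)"
        then show ?thesis using m[of 0 2 2 0] nf[of "?o(9 := c)"] by (simp add: nf_def)
      next
        assume "?t = (0,3,0,1)"
        then show ?thesis using m[of 0 3 0 1] nf[of "?o(1 := c)"] by (simp add: nf_def)
      next
        assume "?t = (1,0,3,0)"
        then show ?thesis using m[of 1 0 3 0] nf[of "?o(6 := c)"] by (simp add: nf_def)
      next
        assume "?t = (1,1,1,1)"
        then show ?thesis using m[of 1 1 1 1] \<sigma> by (simp add: mult.assoc)
      next
        assume "?t = (1,4,0,0)"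
        then show ?thesis using m[of 1 4 0 0] nf[of "?o(10 := c)"] by (simp add: nf_def)
      next
        assume "?t = (2,0,0,2)"
        then show ?thesis using m[of 2 0 0 2] \<rho> by (simp add: mult.assoc)
      next
        assume "?t = (2,2,1,0)"
        then show ?thesis using m[of 2 2 1 0] nf[of "?o(8 := c)"] by (simp add: nf_def)
      next
        assume "?t = (3,0,2,0)"
        then show ?thesis using m[of 3 0 2 0] nf[of "?o(5 := c)"] by (simp add: nf_def)
      next
        assume "?t = (3,1,0,1)"
        then show ?thesis using m[of 3 1 0 1] nf[of "?o(2 := c)"] by (simp add: nf_def)
      next
        assume "?t = (4,2,0,0)"
        then show ?thesis using m[of 4 2 0 0] nf[of "?o(7 := c)"] by (simp add: nf_def)
      next
        assume "?t = (5,0,1,0)"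
        then show ?thesis using m[of 5 0 1 0] nf[of "?o(4 := c)"] by (simp add: nf_def)
      next
        assume "?t = (7,0,0,0)"
        then show ?thesis using m[of 7 0 0 0] nf[of "?o(3 := c)"] by (simp add: nf_def)
      qed
    next
      case (2 i m')
      have m': "single m c = var (4 + i) * single m' c" by (rule 2(3))
      have "weighted_deg gm_weight m' = 7" using wd 2(4) by simp
      from gm_mono_degree_7[OF 2(2) this, of c] show ?thesis
      proof (elim disjE exE conjE)
        fix k assume k: "k < j" "single m' c = cst c * var (4 + k)"
        \<comment> \<open>The coefficient sits at one ordered pair only; \<open>s\<close> is
          symmetrised later.\<close>
        let ?s = "\<lambda>a b. if a = i \<and> b = k then c else 0"
        have "(\<Sum>a<j. \<Sum>b<j. cst (?s a b) * (var (4 + a) * var (4 + b)))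
            = cst c * (var (4 + i) * var (4 + k))"
          using sum_single_index[OF 2(1), of "\<lambda>a. \<Sum>b<j. cst (?s a b) * (var (4 + a) * var (4 + b))"]
            sum_single_index[OF k(1), of "\<lambda>b. cst (?s i b) * (var (4 + i) * var (4 + b))"] by simp
        then have "single m c = gm_general j ?o 0 0 ?o ?o ?o ?s"
          by (simp add: gm_general_def odd_form_def nf_def m' k(2) mult_ac)
        then show ?thesis by blast
      next
        let ?p = "\<lambda>a. if a = i then c else 0"
        assume "single m' c = cst c * (var 0 * var 3)"
        then have "single m c = gm_general j ?o 0 0 ?p ?o ?o (\<lambda>_. ?o)"
          using sum_single_index[OF 2(1), of "\<lambda>a. var (4 + a) * odd_form ?p ?o ?o a"]
          by (simp add: gm_general_def nf_def m' odd_form_def)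
        then show ?thesis by blast
      next
        let ?p = "\<lambda>a. if a = i then c else 0"
        assume "single m' c = cst c * (var 1 * var 2)"
        then have "single m c = gm_general j ?o 0 0 ?o ?p ?o (\<lambda>_. ?o)"
          using sum_single_index[OF 2(1), of "\<lambda>a. var (4 + a) * odd_form ?o ?p ?o a"]
          by (simp add: gm_general_def nf_def m' odd_form_def)
        then show ?thesis by blast
      next
        let ?p = "\<lambda>a. if a = i then c else 0"
        assume "single m' c = cst c * (var 0 ^ 2 * var 1)"
        then have "single m c = gm_general j ?o 0 0 ?o ?o ?p (\<lambda>_. ?o)"
          using sum_single_index[OF 2(1), of "\<lambda>a. var (4 + a) * odd_form ?o ?o ?p a"]
          by (simp add: gm_general_def nf_def m' odd_form_def)
        then show ?thesis by blast
      qed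
    qed
  next
    case zero
    have "0 = gm_general j ?o 0 0 ?o ?o ?o (\<lambda>_. ?o)"
      by (simp add: gm_general_def nf_def odd_form_def)
    then show ?case by blast
  next
    case (add f f')
    then obtain g \<rho> \<sigma> p q r s g' \<rho>' \<sigma>' p' q' r' s' where
      "f = gm_general j g \<rho> \<sigma> p q r s" "f' = gm_general j g' \<rho>' \<sigma>' p' q' r' s'" by blast
    then show ?case by (auto intro: GI simp: gm_general_add)
  qed
  then show thesis using that by blast
qed

lemma gm_general_symmetric:
  "gm_general j g \<rho> \<sigma> p q r s = gm_general j g \<rho> \<sigma> p q r (\<lambda>i k. (s i k + s k i) / 2)"
proof -
  let ?S = "\<lambda>s. \<Sum>i<j. \<Sum>k<j. cst (s i k) * (var (4 + i) * var (4 + k))"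
  have swap: "?S (\<lambda>i k. s k i) = ?S s"
    by (subst sum.swap) (simp add: mult_ac)
  have "?S (\<lambda>i k. (s i k + s k i) / 2) = cst (1/2) * (?S s + ?S (\<lambda>i k. s k i))"
    by (simp add: sum_distrib_left sum.distrib[symmetric] mult.assoc[symmetric] cst_mult[symmetric]
        ring_distribs[symmetric] cst_add[symmetric])
  also have "\<dots> = cst (1/2) * cst 2 * ?S s" unfolding swap by (simp add: algebra_simps)
  also have "\<dots> = ?S s" by (simp only: cst_mult[symmetric]) simp
  finally show ?thesis unfolding gm_general_def by simp
qed

section \<open>What quasi-smoothness says about the coefficients\<close>

lemma quasi_smoothD:
  assumes "quasi_smooth n f" "\<And>i. i \<ge> n \<Longrightarrow> a i = 0" "a l \<noteq> 0" "eval_at a f = 0"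
    "\<And>i. i < n \<Longrightarrow> eval_at a (partial i f) = 0"
  shows False
proof -
  have "a \<in> affine_space n - {\<lambda>_. 0}" using assms(2,3) by (auto simp: affine_space_def)
  then show False using assms unfolding quasi_smooth_def by blast
qed

text \<open>At the point where only \<open>w\<close> survives, a derivative can be nonzero only
  through a monomial \<open>w^k\<close> or \<open>w^k\<close> times one variable. Weight 5 leaves
  just \<open>z * w^2\<close>.\<close>

lemma gm_general_zw2:
  assumes "quasi_smooth (4 + j) (gm_general j g \<rho> \<sigma> p q r s)"
  shows "g 0 \<noteq> 0"
proof
  assume g: "g 0 = 0"
  let ?a = "\<lambda>i. if i = (3::nat) then 1 else 0 :: complex"
  show False
    by (rule quasi_smoothD[OF assms, of ?a 3])
      (simp_all add: gm_general_def eval_at_nf partial_nf odd_form_def nf_defs g)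
qed

text \<open>A nonzero kernel vector, placed in the weight-7 coordinates with the other coordinates
  zero, would be a singular point: every term except the quadratic one vanishes there to second
  order.\<close>

lemma gm_general_nondegenerate:
  assumes qs: "quasi_smooth (4 + j) (gm_general j g \<rho> \<sigma> p q r s)"
    and sym: "\<And>i k. s i k = s k i"
    and v: "\<And>i. i < j \<Longrightarrow> (\<Sum>k<j. s i k * v k) = 0" and l: "l < j"
  shows "v l = 0"
proof (rule ccontr)
  assume vl: "v l \<noteq> 0"
  let ?a = "\<lambda>i. if i < 4 \<or> i \<ge> 4 + j then 0 else v (i - 4)"
  have s1: "(\<Sum>i<j. \<Sum>k<j. s i k * (v i * h k)) = 0" for h
  proof -
    have "(\<Sum>i<j. \<Sum>k<j. s i k * (v i * h k)) = (\<Sum>k<j. h k * (\<Sum>i<j. s k i * v i))"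
      by (subst sum.swap) (simp add: sum_distrib_left sym mult_ac)
    then show ?thesis using v by simp
  qed
  have s2: "(\<Sum>i<j. \<Sum>k<j. s i k * (h i * v k)) = 0" for h
  proof -
    have "(\<Sum>i<j. \<Sum>k<j. s i k * (h i * v k)) = (\<Sum>i<j. h i * (\<Sum>k<j. s i k * v k))"
      by (simp add: sum_distrib_left mult_ac)
    then show ?thesis using v by simp
  qed
  show False
  proof (rule quasi_smoothD[OF qs, of ?a "4 + l"])
    show "eval_at ?a (gm_general j g \<rho> \<sigma> p q r s) = 0"
      by (simp add: gm_general_def eval_at_nf odd_form_def nf_defs s1)
    fix m
    show "eval_at ?a (partial m (gm_general j g \<rho> \<sigma> p q r s)) = 0"
      by (simp add: gm_general_def eval_at_nf partial_nf odd_form_def nf_defs ring_distribs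
          sum.distrib s1 s2)
  qed (use vl l in auto)
qed

text \<open>Trivial kernel means nonzero determinant. Both one-sided identities are recorded:
  \<open>s t = 1\<close> solves for the shift completing the square, \<open>t s = 1\<close> recovers
  the \<open>T i\<close> from the derivatives of the quadratic form.\<close>

lemma symmetric_inverse:
  fixes s :: "nat \<Rightarrow> nat \<Rightarrow> complex"
  assumes "\<And>v l. (\<And>i. i < j \<Longrightarrow> (\<Sum>k<j. s i k * v k) = 0) \<Longrightarrow> l < j \<Longrightarrow> v l = 0"
  obtains t where "\<And>i l. i < j \<Longrightarrow> l < j \<Longrightarrow> (\<Sum>k<j. t i k * s k l) = (if i = l then 1 else 0)"
    "\<And>i l. i < j \<Longrightarrow> l < j \<Longrightarrow> (\<Sum>k<j. s i k * t k l) = (if i = l then 1 else 0)"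
proof -
  let ?A = "mat j j (\<lambda>(i, k). s i k)"
  have A: "?A \<in> carrier_mat j j" by simp
  have "det ?A \<noteq> 0"
  proof
    assume "det ?A = 0"
    then obtain v where v: "v \<in> carrier_vec j" "v \<noteq> 0\<^sub>v j" "?A *\<^sub>v v = 0\<^sub>v j"
      using det_0_iff_vec_prod_zero[OF A] by blast
    have "(\<Sum>k<j. s i k * v $ k) = 0" if "i < j" for i
    proof -
      have "(?A *\<^sub>v v) $ i = 0" using v(3) that by simp
      then show ?thesis using that v(1) by (simp add: scalar_prod_def atLeast0LessThan)
    qed
    then have "v $ l = 0" if "l < j" for l using assms[of "\<lambda>k. v $ k" l] that by blast
    then have "v = 0\<^sub>v j" using v(1) by (intro eq_vecI) auto
    with v(2) show False by simp
  qed
  from det_non_zero_imp_unit[OF A this, of "()"]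
  obtain B where B: "B \<in> carrier_mat j j" "B * ?A = 1\<^sub>m j" "?A * B = 1\<^sub>m j"
    by (auto simp: Units_def ring_mat_def)
  show thesis
  proof
    fix i l assume il: "i < j" "l < j"
    have "(B * ?A) $$ (i, l) = (if i = l then 1 else 0)" using il B(2) by simp
    then show "(\<Sum>k<j. B $$ (i, k) * s k l) = (if i = l then 1 else 0)"
      using il B(1) by (simp add: scalar_prod_def atLeast0LessThan)
    have "(?A * B) $$ (i, l) = (if i = l then 1 else 0)" using il B(3) by simp
    then show "(\<Sum>k<j. s i k * B $$ (k, l)) = (if i = l then 1 else 0)"
      using il B(1) by (simp add: scalar_prod_def atLeast0LessThan)
  qed
qed

text \<open>The normal form in new coordinates, which are written as polynomials in the old
  variables; the shifts are triangular, each involving only variables of smaller weight.\<close>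

definition gm_form :: "nat \<Rightarrow> (nat \<Rightarrow> complex) \<Rightarrow> complex \<Rightarrow> complex \<Rightarrow> (nat \<Rightarrow> complex) \<Rightarrow>
    (nat \<Rightarrow> complex) \<Rightarrow> (nat \<Rightarrow> complex) \<Rightarrow> (nat \<Rightarrow> nat \<Rightarrow> complex) \<Rightarrow> cpoly" where
  "gm_form j g \<zeta> \<omega> p q r s =
     nf (\<lambda>i. cst (g i)) (var 0) (var 1) (var 2 + cst \<zeta> * var 0 ^ 2) (var 3 + cst \<omega> * var 0 * var 1)
     + (\<Sum>i<j. \<Sum>k<j. cst (s i k) * ((var (4 + i) + odd_form p q r i) * (var (4 + k) + odd_form p q r k)))"

text \<open>Coefficients, in the coordinates \<open>z + \<zeta> * x^2\<close> and
  \<open>w + \<omega> * x * y\<close>, of \<open>nf g\<close> enlarged by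
  \<open>g 0 * \<zeta> * x^2 * w^2\<close> and \<open>2 * g 0 * \<omega> * x * y * z * w\<close>.
  These two terms come from expanding \<open>g 0 * z * w^2\<close> in the new coordinates; the other
  new terms are compensated by the changed entries.\<close>

definition nf_shift :: "(nat \<Rightarrow> 'a::comm_ring_1) \<Rightarrow> 'a \<Rightarrow> 'a \<Rightarrow> nat \<Rightarrow> 'a" where
  "nf_shift g \<zeta> \<omega> = g(
     2 := g 2 - 2 * g 0 * \<omega> * \<zeta>,
     3 := g 3 - \<zeta> * g 4 + \<zeta>^2 * g 5 - \<zeta>^3 * g 6,
     4 := g 4 - 2 * \<zeta> * g 5 + 3 * \<zeta>^2 * g 6,
     5 := g 5 - 3 * \<zeta> * g 6,
     7 := g 7 + 2 * g 0 * \<omega>^2 * \<zeta> - g 2 * \<omega> - \<zeta> * g 8 + \<zeta>^2 * g 9,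
     8 := g 8 - g 0 * \<omega>^2 - 2 * \<zeta> * g 9,
     10 := g 10 - g 1 * \<omega>)"

lemma nf_nf_shift:
  "nf (nf_shift g \<zeta> \<omega>) x y (z + \<zeta> * x^2) (w + \<omega> * x * y)
     = nf g x y z w + g 0 * \<zeta> * (x^2 * w^2) + 2 * g 0 * \<omega> * (x * y * z * w)"
  unfolding nf_def nf_shift_def by (simp add: algebra_simps eval_nat_numeral)

lemma cst_nf_shift: "cst (nf_shift g \<zeta> \<omega> i) = nf_shift (\<lambda>i. cst (g i)) (cst \<zeta>) (cst \<omega>) i"
  by (simp add: nf_shift_def cst_add cst_diff cst_mult cst_power)

context
  fixes j :: nat and s :: "nat \<Rightarrow> nat \<Rightarrow> complex"
  assumes sym: "\<And>i k. s i k = s k i"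
begin

definition bil :: "(nat \<Rightarrow> complex) \<Rightarrow> (nat \<Rightarrow> complex) \<Rightarrow> complex" where
  "bil u v = (\<Sum>i<j. \<Sum>k<j. s i k * (u i * v k))"

lemma bil_commute: "bil u v = bil v u"
  unfolding bil_def by (subst sum.swap) (simp add: sym mult_ac)

text \<open>The error term of completing the square. Four of its six monomials belong to
  \<open>nf\<close> (indices 9, 7, 2, 8); the other two are those of \<rho> and \<sigma>.\<close>

lemma quadratic_odd_form:
  "(\<Sum>i<j. \<Sum>k<j. cst (s i k) * (odd_form p q r i * odd_form p q r k))
     = cst (bil p p) * (var 0 ^ 2 * var 3 ^ 2) + cst (bil q q) * (var 1 ^ 2 * var 2 ^ 2)
       + cst (bil r r) * (var 0 ^ 4 * var 1 ^ 2) + cst (2 * bil p q) * (var 0 * var 1 * var 2 * var 3)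
       + cst (2 * bil p r) * (var 0 ^ 3 * var 1 * var 3)
       + cst (2 * bil q r) * (var 0 ^ 2 * var 1 ^ 2 * var 2)"
proof -
  have bilinear: "(\<Sum>i<j. \<Sum>k<j. cst (s i k) * ((cst (u i) * a) * (cst (v k) * b))) = cst (bil u v) * (a * b)" for u v a b
    by (simp add: bil_def cst_sum cst_mult sum_distrib_left sum_distrib_right mult_ac)
  have "(\<Sum>i<j. \<Sum>k<j. cst (s i k) * (odd_form p q r i * odd_form p q r k))
      = (cst (bil p p) * ((var 0 * var 3) * (var 0 * var 3)) + cst (bil p q) * ((var 0 * var 3) * (var 1 * var 2))
         + cst (bil p r) * ((var 0 * var 3) * (var 0 ^ 2 * var 1)))
      + (cst (bil q p) * ((var 1 * var 2) * (var 0 * var 3)) + cst (bil q q) * ((var 1 * var 2) * (var 1 * var 2))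
         + cst (bil q r) * ((var 1 * var 2) * (var 0 ^ 2 * var 1)))
      + (cst (bil r p) * ((var 0 ^ 2 * var 1) * (var 0 * var 3)) + cst (bil r q) * ((var 0 ^ 2 * var 1) * (var 1 * var 2))
         + cst (bil r r) * ((var 0 ^ 2 * var 1) * (var 0 ^ 2 * var 1)))"
    unfolding bilinear[symmetric] odd_form_def sum.distrib[symmetric] by (simp only: ring_distribs add_ac)
  also have "\<dots> = cst (bil p p) * (var 0 ^ 2 * var 3 ^ 2) + cst (bil q q) * (var 1 ^ 2 * var 2 ^ 2)
       + cst (bil r r) * (var 0 ^ 4 * var 1 ^ 2) + cst (2 * bil p q) * (var 0 * var 1 * var 2 * var 3)
       + cst (2 * bil p r) * (var 0 ^ 3 * var 1 * var 3)
       + cst (2 * bil q r) * (var 0 ^ 2 * var 1 ^ 2 * var 2)"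
    unfolding bil_commute[of q p] bil_commute[of r p] bil_commute[of r q] cst_mult cst_numeral
    by (simp add: algebra_simps eval_nat_numeral)
  finally show ?thesis .
qed

text \<open>As usual, the shift is half the inverse quadratic form applied to the linear
  coefficients, separately for the three monomials of \<open>odd_form\<close>.\<close>

lemma complete_square:
  assumes inv: "\<And>i l. i < j \<Longrightarrow> l < j \<Longrightarrow> (\<Sum>k<j. s i k * t k l) = (if i = l then 1 else 0)"
  obtains p' q' r' where "(\<Sum>i<j. var (4 + i) * odd_form p q r i)
      + (\<Sum>i<j. \<Sum>k<j. cst (s i k) * (var (4 + i) * var (4 + k)))
      + (\<Sum>i<j. \<Sum>k<j. cst (s i k) * (odd_form p' q' r' i * odd_form p' q' r' k))
    = (\<Sum>i<j. \<Sum>k<j. cst (s i k) * ((var (4 + i) + odd_form p' q' r' i) * (var (4 + k) + odd_form p' q' r' k)))"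
proof -
  \<comment> \<open>\<open>h u\<close> solves \<open>s (h u) = u / 2\<close>; the factor 1/2 is
    right because the two cross terms coincide by symmetry of \<open>s\<close>.\<close>
  define h where "h u k = (\<Sum>l<j. t k l * (u l / 2))" for u :: "nat \<Rightarrow> complex" and k
  have h: "(\<Sum>k<j. s i k * h u k) = u i / 2" if "i < j" for u i
  proof -
    have "(\<Sum>k<j. s i k * h u k) = (\<Sum>l<j. (\<Sum>k<j. s i k * t k l) * (u l / 2))"
      unfolding h_def by (simp only: sum_distrib_left sum_distrib_right mult.assoc) (rule sum.swap)
    also have "\<dots> = (\<Sum>l<j. if i = l then u l / 2 else 0)"
      by (rule sum.cong) (use inv that in auto)
    finally show ?thesis using that by simp
  qed
  let ?L = "odd_form (h p) (h q) (h r)"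
  have L: "(\<Sum>k<j. cst (s i k) * ?L k) = cst (1/2) * odd_form p q r i" if "i < j" for i
  proof -
    have "(\<Sum>k<j. cst (s i k) * ?L k) = cst (\<Sum>k<j. s i k * h p k) * (var 0 * var 3)
       + cst (\<Sum>k<j. s i k * h q k) * (var 1 * var 2) + cst (\<Sum>k<j. s i k * h r k) * (var 0 ^ 2 * var 1)"
      unfolding odd_form_def cst_sum cst_mult by (simp only: ring_distribs sum.distrib sum_distrib_right mult.assoc)
    also have "\<dots> = cst (p i * (1/2)) * (var 0 * var 3) + cst (q i * (1/2)) * (var 1 * var 2)
       + cst (r i * (1/2)) * (var 0 ^ 2 * var 1)" unfolding h[OF that] by simp
    also have "\<dots> = cst (1/2) * odd_form p q r i"
      unfolding odd_form_def cst_mult by (simp only: ring_distribs mult_ac)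
    finally show ?thesis .
  qed
  have TL: "(\<Sum>i<j. \<Sum>k<j. cst (s i k) * (var (4 + i) * ?L k)) = cst (1/2) * (\<Sum>i<j. var (4 + i) * odd_form p q r i)"
  proof -
    have "(\<Sum>i<j. \<Sum>k<j. cst (s i k) * (var (4 + i) * ?L k)) = (\<Sum>i<j. var (4 + i) * (\<Sum>k<j. cst (s i k) * ?L k))"
      by (simp only: sum_distrib_left mult.left_commute)
    also have "\<dots> = (\<Sum>i<j. cst (1/2) * (var (4 + i) * odd_form p q r i))"
      by (rule sum.cong) (auto simp: L mult.left_commute)
    finally show ?thesis by (simp only: sum_distrib_left)
  qed
  have LT: "(\<Sum>i<j. \<Sum>k<j. cst (s i k) * (?L i * var (4 + k))) = (\<Sum>i<j. \<Sum>k<j. cst (s i k) * (var (4 + i) * ?L k))"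
    by (subst sum.swap) (simp add: sym mult_ac)
  have half: "cst (1/2) * x + cst (1/2) * x = x" for x
    by (simp only: distrib_right[symmetric] cst_add[symmetric]) simp
  have "(\<Sum>i<j. \<Sum>k<j. cst (s i k) * ((var (4 + i) + ?L i) * (var (4 + k) + ?L k)))
     = (\<Sum>i<j. \<Sum>k<j. cst (s i k) * (var (4 + i) * var (4 + k)))
       + (\<Sum>i<j. \<Sum>k<j. cst (s i k) * (var (4 + i) * ?L k))
       + ((\<Sum>i<j. \<Sum>k<j. cst (s i k) * (?L i * var (4 + k)))
       + (\<Sum>i<j. \<Sum>k<j. cst (s i k) * (?L i * ?L k)))"
    by (simp only: ring_distribs sum.distrib add_ac)
  also have "\<dots> = (\<Sum>i<j. \<Sum>k<j. cst (s i k) * (var (4 + i) * var (4 + k)))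
       + (cst (1/2) * (\<Sum>i<j. var (4 + i) * odd_form p q r i) + cst (1/2) * (\<Sum>i<j. var (4 + i) * odd_form p q r i))
       + (\<Sum>i<j. \<Sum>k<j. cst (s i k) * (?L i * ?L k))"
    unfolding LT TL by (simp only: add_ac)
  finally show thesis unfolding half by (intro that[of "h p" "h q" "h r"]) (simp only: add_ac)
qed

lemma gm_general_eq_gm_form:
  assumes inv: "\<And>i l. i < j \<Longrightarrow> l < j \<Longrightarrow> (\<Sum>k<j. s i k * t k l) = (if i = l then 1 else 0)"
    and g0: "g 0 \<noteq> 0"
  obtains g' \<zeta> \<omega> p' q' r' where "gm_general j g \<rho> \<sigma> p q r s = gm_form j g' \<zeta> \<omega> p' q' r' s"
proof -
  obtain p' q' r' where sq: "(\<Sum>i<j. var (4 + i) * odd_form p q r i)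
      + (\<Sum>i<j. \<Sum>k<j. cst (s i k) * (var (4 + i) * var (4 + k)))
      + (\<Sum>i<j. \<Sum>k<j. cst (s i k) * (odd_form p' q' r' i * odd_form p' q' r' k))
    = (\<Sum>i<j. \<Sum>k<j. cst (s i k) * ((var (4 + i) + odd_form p' q' r' i) * (var (4 + k) + odd_form p' q' r' k)))"
    by (rule complete_square[OF inv])
  \<comment> \<open>The coefficients of \<open>nf\<close> after subtracting the error term of the
    completed square.\<close>
  define g1 where "g1 = g(2 := g 2 - 2 * bil p' r', 7 := g 7 - bil r' r', 8 := g 8 - 2 * bil q' r',
    9 := g 9 - bil q' q')"
  \<comment> \<open>\<zeta> and \<omega> solve \<open>g 0 * \<zeta> = \<rho> - bil p' p'\<close> and
    \<open>2 * g 0 * \<omega> = \<sigma> - 2 * bil p' q'\<close>, so the shifts absorb what is left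
    of \<rho> and \<sigma>.\<close>
  define \<zeta> where "\<zeta> = (\<rho> - bil p' p') / g 0"
  define \<omega> where "\<omega> = (\<sigma> - 2 * bil p' q') / (2 * g 0)"
  have \<zeta>: "cst \<rho> = cst (g1 0) * cst \<zeta> + cst (bil p' p')"
    unfolding cst_mult[symmetric] cst_add[symmetric] using g0 by (simp add: \<zeta>_def g1_def)
  have "g1 0 * \<omega> * 2 + 2 * bil p' q' = \<sigma>" using g0 by (simp add: \<omega>_def g1_def field_simps)
  then have \<omega>: "cst \<sigma> = 2 * cst (g1 0) * cst \<omega> + cst (2 * bil p' q')"
    by (metis cst_add cst_mult cst_numeral mult.commute mult.left_commute)
  let ?nf = "\<lambda>g. nf (\<lambda>i. cst (g i)) (var 0) (var 1) (var 2) (var 3)"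
  have g: "?nf g = ?nf g1 + cst (bil q' q') * (var 1 ^ 2 * var 2 ^ 2)
       + cst (bil r' r') * (var 0 ^ 4 * var 1 ^ 2) + cst (2 * bil p' r') * (var 0 ^ 3 * var 1 * var 3)
       + cst (2 * bil q' r') * (var 0 ^ 2 * var 1 ^ 2 * var 2)"
    by (simp add: nf_def g1_def cst_diff algebra_simps)
  have "gm_general j g \<rho> \<sigma> p q r s = gm_form j (nf_shift g1 \<zeta> \<omega>) \<zeta> \<omega> p' q' r' s"
    unfolding gm_form_def cst_nf_shift nf_nf_shift sq[symmetric] quadratic_odd_form gm_general_def \<zeta> \<omega> g
    by (simp add: algebra_simps)
  then show thesis by (rule that)
qed

end

lemma gm_normal_form:
  assumes "gm_member j f"
  obtains g \<zeta> \<omega> p q r s t where "f = gm_form j g \<zeta> \<omega> p q r s" "\<And>i k. s i k = s k i"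
    "\<And>i l. i < j \<Longrightarrow> l < j \<Longrightarrow> (\<Sum>k<j. t i k * s k l) = (if i = l then 1 else 0)"
proof -
  have hom: "f \<in> homogeneous_polys (4 + j) gm_weight 14" and qs: "quasi_smooth (4 + j) f"
    using assms by (auto simp: gm_member_def)
  obtain g \<rho> \<sigma> p q r s0 where "f = gm_general j g \<rho> \<sigma> p q r s0"
    using gm_general_exists[OF hom] by blast
  moreover define s where "s i k = (s0 i k + s0 k i) / 2" for i k
  ultimately have f: "f = gm_general j g \<rho> \<sigma> p q r s"
    using gm_general_symmetric[of j g \<rho> \<sigma> p q r s0] unfolding s_def by metis
  have sym: "s i k = s k i" for i k by (simp add: s_def add.commute)
  note qs' = qs[unfolded f]
  obtain t where t: "\<And>i l. i < j \<Longrightarrow> l < j \<Longrightarrow> (\<Sum>k<j. t i k * s k l) = (if i = l then 1 else 0)"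
    "\<And>i l. i < j \<Longrightarrow> l < j \<Longrightarrow> (\<Sum>k<j. s i k * t k l) = (if i = l then 1 else 0)"
    using symmetric_inverse[of j s] gm_general_nondegenerate[OF qs' sym] by blast
  obtain g' \<zeta> \<omega> p' q' r' where "f = gm_form j g' \<zeta> \<omega> p' q' r' s"
    using gm_general_eq_gm_form[where s = s and j = j and t = t and g = g and \<rho> = \<rho> and \<sigma> = \<sigma>
        and p = p and q = q and r = r, OF sym t(2) gm_general_zw2[OF qs']] f by blast
  with sym t(1) that show thesis by blast
qed

section \<open>Odd dimension\<close>

locale gm_normal_form =
  fixes j :: nat and f :: cpoly and g :: "nat \<Rightarrow> complex" and \<zeta> \<omega> :: complex
    and p q r :: "nat \<Rightarrow> complex" and s t :: "nat \<Rightarrow> nat \<Rightarrow> complex"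
  assumes member: "gm_member j f"
    and form: "f = gm_form j g \<zeta> \<omega> p q r s"
    and sym: "\<And>i k. s i k = s k i"
    and inv: "\<And>i l. i < j \<Longrightarrow> l < j \<Longrightarrow> (\<Sum>k<j. t i k * s k l) = (if i = l then 1 else 0)"
begin

abbreviation Z :: cpoly where "Z \<equiv> var 2 + cst \<zeta> * var 0 ^ 2"
abbreviation W :: cpoly where "W \<equiv> var 3 + cst \<omega> * var 0 * var 1"
abbreviation T :: "nat \<Rightarrow> cpoly" where "T i \<equiv> var (4 + i) + odd_form p q r i"
abbreviation c :: "nat \<Rightarrow> cpoly" where "c i \<equiv> cst (g i)"

lemma hom: "f \<in> homogeneous_polys (4 + j) gm_weight (int 14)"
  using member by (simp add: gm_member_def)

sublocale jacobian "4 + j" f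
  by unfold_locales (use hom in \<open>simp add: homogeneous_polys_def\<close>)

lemma polys_odd_form: "odd_form p q r i \<in> polys (4 + j)"
  unfolding odd_form_def by (intro polys_intros) auto

lemma polys_T: "i < j \<Longrightarrow> T i \<in> polys (4 + j)"
  by (intro polys_add polys_odd_form polys_var) auto

lemma polys_nf: "nf_wy c (var 0) (var 1) Z \<in> polys (4 + j)" "nf_ww c (var 0) (var 1) Z \<in> polys (4 + j)"
  "nf_yy c (var 0) (var 1) Z \<in> polys (4 + j)" "nf_yw c (var 0) (var 1) Z \<in> polys (4 + j)"
  unfolding nf_wy_def nf_ww_def nf_yy_def nf_yw_def by (intro polys_intros; simp)+

lemma partial_f:
  "partial m f = nf_x c (var 0) (var 1) Z W * partial m (var 0) + nf_y c (var 0) (var 1) Z W * partial m (var 1)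
     + nf_z c (var 0) (var 1) Z W * partial m Z + nf_w c (var 0) (var 1) Z W * partial m W
     + (\<Sum>i<j. \<Sum>k<j. cst (s i k) * (partial m (T i) * T k + T i * partial m (T k)))"
  unfolding form gm_form_def partial_add partial_nf partial_sum partial_mult partial_cst by simp

lemma partial_f_T:
  assumes "l < j"
  shows "partial (4 + l) f = cst 2 * (\<Sum>k<j. cst (s l k) * T k)"
proof -
  have T: "partial (4 + l) (T i) = (if i = l then 1 else 0)" for i
    by (simp add: odd_form_def)
  have "partial (4 + l) f = (\<Sum>i<j. \<Sum>k<j. cst (s i k) * (partial (4 + l) (T i) * T k + T i * partial (4 + l) (T k)))"
    by (subst partial_f) simp
  also have "\<dots> = (\<Sum>i<j. \<Sum>k<j. cst (s i k) * (partial (4 + l) (T i) * T k))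
      + (\<Sum>i<j. \<Sum>k<j. cst (s i k) * (T i * partial (4 + l) (T k)))"
    by (simp only: ring_distribs sum.distrib)
  also have "(\<Sum>i<j. \<Sum>k<j. cst (s i k) * (T i * partial (4 + l) (T k)))
      = (\<Sum>i<j. \<Sum>k<j. cst (s i k) * (partial (4 + l) (T i) * T k))"
    by (subst sum.swap) (simp only: sym mult_ac)
  also have "(\<Sum>i<j. \<Sum>k<j. cst (s i k) * (partial (4 + l) (T i) * T k)) = (\<Sum>k<j. cst (s l k) * T k)"
    unfolding T
    using sum_single_index[OF assms, of "\<lambda>i. \<Sum>k<j. cst (s i k) * ((if i = l then 1 else 0) * T k)"]
    by simp
  finally show ?thesis by simp
qed

text \<open>The derivatives in the weight-7 variables form the vector \<open>2 s T\<close>, and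
  \<open>t\<close> inverts \<open>s\<close>.\<close>

lemma T_in_J:
  assumes "i < j" shows "T i \<in> J"
proof -
  have "(\<Sum>l<j. cst (t i l) * partial (4 + l) f) = (\<Sum>l<j. cst (t i l) * (cst 2 * (\<Sum>k<j. cst (s l k) * T k)))"
    by (rule sum.cong) (simp_all only: partial_f_T lessThan_iff)
  also have "\<dots> = (\<Sum>k<j. \<Sum>l<j. cst 2 * (cst (t i l * s l k) * T k))"
    by (subst sum.swap) (simp only: sum_distrib_left cst_mult mult_ac)
  also have "\<dots> = (\<Sum>k<j. cst 2 * (cst (\<Sum>l<j. t i l * s l k) * T k))"
    by (simp only: cst_sum sum_distrib_left sum_distrib_right)
  also have "\<dots> = cst 2 * (cst (\<Sum>l<j. t i l * s l i) * T i)"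
    by (rule sum_single_index[OF assms]) (use inv[OF assms] in auto)
  also have "\<dots> = cst 2 * T i" using inv[OF assms assms] by simp
  finally have eq: "T i = cst (1/2) * (\<Sum>l<j. cst (t i l) * partial (4 + l) f)"
    by (simp add: mult.assoc[symmetric] cst_mult[symmetric] del: cst_numeral)
  have "(\<Sum>l<j. cst (t i l) * partial (4 + l) f) \<in> J"
    by (intro J_sum J_mult_left J_partial polys_cst) auto
  then show ?thesis by (subst eq) (rule J_mult_left, assumption, rule polys_cst)
qed

text \<open>Every summand keeps a factor \<open>T i\<close> or \<open>T k\<close>. Modulo
  \<open>J\<close>, the remaining derivatives of \<open>f\<close> are therefore those of the part in
  four variables.\<close>

lemma quadratic_part_in_J:
  "(\<Sum>i<j. \<Sum>k<j. cst (s i k) * (partial m (T i) * T k + T i * partial m (T k))) \<in> J"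
  by (intro J_sum J_mult_left[OF _ polys_cst] J_add J_mult_left[OF T_in_J] J_mult_right[OF T_in_J])
    (simp_all only: lessThan_iff polys_partial polys_T)

lemma nf_w_in_J: "nf_w c (var 0) (var 1) Z W \<in> J"
proof -
  have "partial 3 f - (\<Sum>i<j. \<Sum>k<j. cst (s i k) * (partial 3 (T i) * T k + T i * partial 3 (T k))) \<in> J"
    by (intro J_diff J_partial quadratic_part_in_J) simp
  then show ?thesis by (subst (asm) partial_f) simp
qed

lemma nf_y_in_J: "nf_y c (var 0) (var 1) Z W \<in> J"
proof -
  \<comment> \<open>The last term is subtracted because \<open>W\<close> also depends on
    \<open>var 1\<close>, with derivative \<open>\<omega> * var 0\<close>.\<close>
  have "partial 1 f - (\<Sum>i<j. \<Sum>k<j. cst (s i k) * (partial 1 (T i) * T k + T i * partial 1 (T k)))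
      - cst \<omega> * var 0 * nf_w c (var 0) (var 1) Z W \<in> J"
    by (intro J_diff J_partial quadratic_part_in_J J_mult_left nf_w_in_J polys_intros) simp_all
  then show ?thesis by (subst (asm) partial_f) (simp add: mult_ac)
qed

section \<open>The class annihilating everything of odd degree\<close>

definition kernel_element :: cpoly where
  "kernel_element = var 0 * nf_det c (var 0) (var 1) Z"

lemma kernel_element_homogeneous: "kernel_element \<in> homogeneous_polys (4 + j) gm_weight (int 14)"
proof -
  let ?H = "homogeneous_polys (4 + j) gm_weight"
  have X: "var 0 \<in> ?H 2" and Y: "var 1 \<in> ?H 3" and Z0: "var 2 \<in> ?H 4"
    using homogeneous_polys_var[of 0 "4 + j" gm_weight] homogeneous_polys_var[of 1 "4 + j" gm_weight]
      homogeneous_polys_var[of 2 "4 + j" gm_weight] by simp_all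
  have cst: "cst a * b \<in> ?H k" if "b \<in> ?H k" for a b k
    using homogeneous_polys_mult[OF homogeneous_polys_cst that] by simp
  have num: "numeral a * b \<in> ?H k" if "b \<in> ?H k" for a b k
    using homogeneous_polys_mult[OF homogeneous_polys_numeral that] by simp
  note pow = homogeneous_polys_power
  have X2: "var 0 ^ 2 \<in> ?H 4" and X3: "var 0 ^ 3 \<in> ?H 6" and X4: "var 0 ^ 4 \<in> ?H 8"
    and Y2: "var 1 ^ 2 \<in> ?H 6"
    by (rule pow[OF X] pow[OF Y]; simp)+
  have Z: "Z \<in> ?H 4" by (intro homogeneous_polys_add cst Z0 X2)
  have Z2: "Z ^ 2 \<in> ?H 8" by (rule pow[OF Z]) simp
  have "nf_wy c (var 0) (var 1) Z \<in> ?H 6" "nf_yw c (var 0) (var 1) Z \<in> ?H 6"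
    unfolding nf_wy_def nf_yw_def mult.assoc by (intro homogeneous_polys_add cst num X3 Y2)+
  moreover have "nf_ww c (var 0) (var 1) Z \<in> ?H 4"
    unfolding nf_ww_def mult.assoc by (intro cst num Z)
  moreover have "nf_yy c (var 0) (var 1) Z \<in> ?H 8"
    unfolding nf_yy_def mult.assoc
    by (intro homogeneous_polys_add cst num X4 Z2 homogeneous_polys_mult[OF X2 Z] homogeneous_polys_mult[OF X Y2]) simp_all
  ultimately have "nf_det c (var 0) (var 1) Z \<in> ?H 12"
    unfolding nf_det_def by (intro homogeneous_polys_diff) (auto intro: homogeneous_polys_mult)
  then show ?thesis unfolding kernel_element_def by (intro homogeneous_polys_mult[OF X]) simp_all
qed

lemma kernel_element_polys: "kernel_element \<in> polys (4 + j)"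
  using kernel_element_homogeneous by (simp add: homogeneous_polys_def)

lemma kernel_element_mult_var1: "kernel_element * var 1 \<in> J"
proof -
  have "kernel_element * var 1 = var 0 * (nf_yw c (var 0) (var 1) Z * nf_w c (var 0) (var 1) Z W
      - nf_ww c (var 0) (var 1) Z * nf_y c (var 0) (var 1) Z W)"
    unfolding kernel_element_def nf_det_mult_y[symmetric] by (rule mult.assoc)
  also have "\<dots> \<in> J"
    by (intro J_mult_left J_diff nf_w_in_J nf_y_in_J polys_nf polys_var) simp
  finally show ?thesis .
qed

lemma kernel_element_mult_W: "kernel_element * W \<in> J"
proof -
  have "kernel_element * W = var 0 * (nf_wy c (var 0) (var 1) Z * nf_y c (var 0) (var 1) Z W
      - nf_yy c (var 0) (var 1) Z * nf_w c (var 0) (var 1) Z W)"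
    unfolding kernel_element_def nf_det_mult_w[symmetric] by (rule mult.assoc)
  also have "\<dots> \<in> J"
    by (intro J_mult_left J_diff nf_w_in_J nf_y_in_J polys_nf polys_var) simp
  finally show ?thesis .
qed

lemma kernel_element_mult_var3: "kernel_element * var 3 \<in> J"
proof -
  have "kernel_element * W - cst \<omega> * var 0 * (kernel_element * var 1) \<in> J"
    by (intro J_diff kernel_element_mult_W J_mult_left kernel_element_mult_var1 polys_intros) simp
  then show ?thesis by (simp add: algebra_simps)
qed

text \<open>Each monomial of \<open>odd_form\<close> contains \<open>var 1\<close> or
  \<open>var 3\<close>, and \<open>T i\<close> itself lies in \<open>J\<close>.\<close>

lemma kernel_element_mult_varT:
  assumes "i < j" shows "kernel_element * var (4 + i) \<in> J"
proof -
  have "kernel_element * T i - (cst (p i) * var 0 * (kernel_element * var 3)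
      + cst (q i) * var 2 * (kernel_element * var 1) + cst (r i) * var 0 ^ 2 * (kernel_element * var 1)) \<in> J"
    by (intro J_diff J_add J_mult_left T_in_J kernel_element_mult_var3 kernel_element_mult_var1
        kernel_element_polys assms polys_intros) simp_all
  then show ?thesis by (simp add: odd_form_def algebra_simps)
qed

lemma kernel_element_mult_odd:
  assumes h: "h \<in> homogeneous_polys (4 + j) gm_weight k" and "odd k"
  shows "kernel_element * h \<in> J"
  using h
proof (induction rule: homogeneous_polys_induct)
  case (single m a)
  have "odd (weighted_deg gm_weight m)" using single(2) \<open>odd k\<close> by (metis even_of_nat_iff)
  \<comment> \<open>If all occurring variables had even weight, the weighted degree would be
    even.\<close>
  then obtain i where i: "i \<in> keys m" "odd (gm_weight i)"
    unfolding weighted_deg_def by (meson dvd_mult2 dvd_sum)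
  obtain m' where m': "keys m' \<subseteq> keys m" "single m a = var i * single m' a"
    using split_off_var[OF i(1)] by metis
  have "i < 4 + j" using i(1) single(1) by auto
  have "i \<noteq> 0" "i \<noteq> 2" using i(2) by (metis even_numeral gm_weight_simps(1), metis even_numeral gm_weight_simps(3))
  then have "i = 1 \<or> i = 3 \<or> (\<exists>l<j. i = 4 + l)"
    using \<open>i < 4 + j\<close> by presburger
  then have "kernel_element * var i \<in> J"
    using kernel_element_mult_var1 kernel_element_mult_var3 kernel_element_mult_varT by auto
  then have "kernel_element * var i * single m' a \<in> J"
    by (rule J_mult_right) (use m'(1) single(1) in \<open>auto intro: polys_single\<close>)
  then show ?case by (simp add: m'(2) mult.assoc)
qed (simp_all add: J_0 J_add ring_distribs)

text \<open>The points of the linear slice on which all \<open>T i\<close> vanish, in the coordinates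
  \<open>var 0\<close>, \<open>var 1\<close>, \<open>Z\<close>, \<open>W\<close>.\<close>

definition pt :: "complex \<Rightarrow> complex \<Rightarrow> complex \<Rightarrow> complex \<Rightarrow> nat \<Rightarrow> complex" where
  "pt x y z w i = (if i = 0 then x else if i = 1 then y else if i = 2 then z - \<zeta> * x^2
     else if i = 3 then w - \<omega> * x * y else if i < 4 + j
     then - (p (i - 4) * (x * (w - \<omega> * x * y)) + q (i - 4) * (y * (z - \<zeta> * x^2)) + r (i - 4) * (x^2 * y))
     else 0)"

section \<open>Restriction to the slice and non-membership in the Jacobian ideal\<close>

lemma eval_pt:
  "eval_at (pt x y z w) (var 0) = x" "eval_at (pt x y z w) (var 1) = y"
  "eval_at (pt x y z w) Z = z" "eval_at (pt x y z w) W = w" "i < j \<Longrightarrow> eval_at (pt x y z w) (T i) = 0"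
  by (simp_all add: pt_def odd_form_def)

text \<open>The part quadratic in the \<open>T i\<close> has zero gradient where all
  \<open>T i\<close> vanish, so only the chain rule for \<open>nf\<close> remains.\<close>

lemma eval_pt_partial_f:
  "eval_at (pt x y z w) (partial m f) =
     nf_x g x y z w * eval_at (pt x y z w) (partial m (var 0)) + nf_y g x y z w * eval_at (pt x y z w) (partial m (var 1))
     + nf_z g x y z w * eval_at (pt x y z w) (partial m Z) + nf_w g x y z w * eval_at (pt x y z w) (partial m W)"
proof -
  have "eval_at (pt x y z w) (\<Sum>i<j. \<Sum>k<j. cst (s i k) * (partial m (T i) * T k + T i * partial m (T k))) = 0"
    unfolding eval_at_sum eval_at_mult eval_at_add[of _ "partial m _ * _"]
    by (intro sum.neutral ballI) (simp only: eval_pt lessThan_iff mult_zero_right mult_zero_left add_0_right)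
  then show ?thesis
    unfolding partial_f[of m] eval_at_add[of _ _ "sum _ _"] eval_at_add[of _ "_ * _" "_ * _"]
      eval_at_add[of _ "_ + _" "_ * partial m _"]
    by (simp only: eval_at_mult eval_at_nf eval_pt eval_at_add[of _ "_ * partial m _"] add_0_right)
qed

text \<open>Quasi-smoothness passes from \<open>f\<close> to \<open>nf g\<close>: on the slice
  \<open>f\<close> takes the value of \<open>nf g\<close>, and its gradient is a combination of the
  four derivatives of \<open>nf g\<close>.\<close>

lemma nf_smooth:
  assumes "x \<noteq> 0 \<or> y \<noteq> 0 \<or> z \<noteq> 0 \<or> w \<noteq> 0" "nf g x y z w = 0"
    "nf_x g x y z w = 0" "nf_y g x y z w = 0" "nf_z g x y z w = 0" "nf_w g x y z w = 0"
  shows False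
proof -
  \<comment> \<open>The coordinate change is triangular, so only the origin is sent to the
    origin.\<close>
  have "\<exists>l. pt x y z w l \<noteq> 0"
  proof (rule ccontr)
    assume "\<not> ?thesis"
    then have z: "pt x y z w l = 0" for l by blast
    from z[of 0] z[of 1] z[of 2] z[of 3] assms(1) show False by (simp add: pt_def)
  qed
  then obtain l where l: "pt x y z w l \<noteq> 0" by blast
  have qs: "quasi_smooth (4 + j) f" using member by (simp add: gm_member_def)
  show False
  proof (rule quasi_smoothD[where a = "pt x y z w", OF qs _ l])
    have "eval_at (pt x y z w) (\<Sum>i<j. \<Sum>k<j. cst (s i k) * (T i * T k)) = 0"
      unfolding eval_at_sum eval_at_mult
      by (intro sum.neutral ballI) (simp only: eval_pt lessThan_iff mult_zero_right)
    then show "eval_at (pt x y z w) f = 0"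
      unfolding form gm_form_def eval_at_add[of _ _ "sum _ _"] eval_at_nf eval_pt
      by (simp only: assms add_0_right)
    show "eval_at (pt x y z w) (partial m f) = 0" for m
      unfolding eval_pt_partial_f by (simp only: assms mult_zero_left add_0_right)
  qed (simp add: pt_def)
qed

text \<open>Smoothness at the four coordinate points. At each, the only relevant monomials are
  powers of the surviving variable, possibly times one further variable: \<open>z * w^2\<close>;
  \<open>x * z^3\<close>; \<open>y^3 * w\<close>, \<open>x * y^4\<close>; \<open>x^7\<close>,
  \<open>x^5 * z\<close>.\<close>

lemma coefficients_nonzero: "g 0 \<noteq> 0" "g 6 \<noteq> 0" "g 1 \<noteq> 0 \<or> g 10 \<noteq> 0" "g 3 \<noteq> 0 \<or> g 4 \<noteq> 0"
  using nf_smooth[of 0 0 0 1] nf_smooth[of 0 0 1 0] nf_smooth[of 0 1 0 0] nf_smooth[of 1 0 0 0]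
  by (auto simp: nf_defs)

lemma kernel_element_notin_J: "kernel_element \<notin> J"
proof
  assume "kernel_element \<in> J"
  from J_combination_homogeneous[OF hom kernel_element_homogeneous this]
  obtain h where h: "\<And>i. i < 4 + j \<Longrightarrow> h i \<in> homogeneous_polys (4 + j) gm_weight (int (gm_weight i))"
    "kernel_element = (\<Sum>i<4 + j. h i * partial i f)" by blast
  have h_degree: "h 0 \<in> homogeneous_polys (4 + j) gm_weight 2" "h 1 \<in> homogeneous_polys (4 + j) gm_weight 3"
    "h 2 \<in> homogeneous_polys (4 + j) gm_weight 4" "h 3 \<in> homogeneous_polys (4 + j) gm_weight 5"
    using h(1)[of 0] h(1)[of 1] h(1)[of 2] h(1)[of 3] by simp_all
  obtain a where a: "h 0 = cst a * var 0"
    by (rule gm_degree_2[OF h_degree(1)])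
  obtain \<gamma> where \<gamma>: "h 1 = cst \<gamma> * var 1"
    by (rule gm_degree_3[OF h_degree(2)])
  obtain \<alpha> \<beta> where \<alpha>\<beta>: "h 2 = cst \<alpha> * var 0 ^ 2 + cst \<beta> * var 2"
    by (rule gm_degree_4[OF h_degree(3)])
  obtain \<epsilon> \<delta> where \<epsilon>\<delta>: "h 3 = cst \<epsilon> * var 0 * var 1 + cst \<delta> * var 3"
    by (rule gm_degree_5[OF h_degree(4)])
  \<comment> \<open>The same vector field in the coordinates \<open>Z\<close>, \<open>W\<close>: the
    chain rule adds \<open>2 * a * \<zeta>\<close> and \<open>(a + \<gamma>) * \<omega>\<close>,
    while \<open>z = Z - \<zeta> * x^2\<close> and \<open>w = W - \<omega> * x * y\<close>
    contribute \<open>- \<beta> * \<zeta>\<close> and \<open>- \<delta> * \<omega>\<close>.\<close>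
  have "a * x * nf_x g x y z w + \<gamma> * y * nf_y g x y z w
      + (\<beta> * z + (2 * a * \<zeta> + \<alpha> - \<beta> * \<zeta>) * x^2) * nf_z g x y z w
      + (\<delta> * w + (a * \<omega> + \<gamma> * \<omega> + \<epsilon> - \<delta> * \<omega>) * x * y) * nf_w g x y z w
      = x * nf_det g x y z" for x y z w
  proof -
    let ?e = "eval_at (pt x y z w)"
    have zero: "?e (partial i f) = 0" if "i \<ge> 4" for i
      using that unfolding eval_pt_partial_f by simp
    have "x * nf_det g x y z = ?e kernel_element"
      unfolding kernel_element_def eval_at_mult eval_at_nf eval_pt ..
    also have "\<dots> = (\<Sum>i<4 + j. ?e (h i) * ?e (partial i f))"
      unfolding h(2) by simp
    also have "\<dots> = (\<Sum>i<4. ?e (h i) * ?e (partial i f))"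
      by (rule sum.mono_neutral_right) (auto simp: zero)
    also have "\<dots> = ?e (h 0) * ?e (partial 0 f) + ?e (h 1) * ?e (partial 1 f)
        + ?e (h 2) * ?e (partial 2 f) + ?e (h 3) * ?e (partial 3 f)"
      by (simp add: eval_nat_numeral lessThan_Suc add_ac)
    also have "\<dots> = a * x * (nf_x g x y z w + 2 * \<zeta> * x * nf_z g x y z w + \<omega> * y * nf_w g x y z w)
        + \<gamma> * y * (nf_y g x y z w + \<omega> * x * nf_w g x y z w)
        + (\<alpha> * x^2 + \<beta> * (z - \<zeta> * x^2)) * nf_z g x y z w
        + (\<epsilon> * x * y + \<delta> * (w - \<omega> * x * y)) * nf_w g x y z w"
      unfolding eval_pt_partial_f a \<gamma> \<alpha>\<beta> \<epsilon>\<delta> by (simp add: pt_def mult_ac)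
    finally show ?thesis by (simp add: algebra_simps power2_eq_square)
  qed
  from nf_det_not_infinitesimally_trivial[OF coefficients_nonzero this] show False .
qed

lemma anti_torelli:
  assumes "odd j" shows "gm_anti_torelli j f"
  unfolding gm_anti_torelli_def
proof (rule anti_torelli_typeI[OF kernel_element_homogeneous kernel_element_notin_J])
  fix q0 h assume h: "h \<in> homogeneous_polys (4 + j) gm_weight ((int q0 + 1) * int 14 - int (\<Sum>i<4 + j. gm_weight i))"
  have "odd ((int q0 + 1) * int 14 - int (\<Sum>i<4 + j. gm_weight i))"
    unfolding sum_gm_weight using assms by simp
  from kernel_element_mult_odd[OF h this] show "kernel_element * h \<in> J" .
qed

end

lemma gm_anti_torelli_odd:
  assumes "gm_member j f" "odd j" shows "gm_anti_torelli j f"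
proof -
  obtain g \<zeta> \<omega> p q r s t where "f = gm_form j g \<zeta> \<omega> p q r s" "\<And>i k. s i k = s k i"
    "\<And>i l. i < j \<Longrightarrow> l < j \<Longrightarrow> (\<Sum>k<j. t i k * s k l) = (if i = l then 1 else 0)"
    using gm_normal_form[OF assms(1)] by blast
  then interpret gm_normal_form j f g \<zeta> \<omega> p q r s t
    using assms(1) by unfold_locales
  show ?thesis using assms(2) by (rule anti_torelli)
qed

lemma gm_torelli_even:
  assumes "gm_member j f" "even j" shows "gm_torelli j f"
proof -
  interpret jacobian "4 + j" f
    using assms(1) by unfold_locales (simp add: gm_member_def homogeneous_polys_def)
  from assms(2) obtain k where "j = 2 * k" by blast
  then show ?thesis
    \<comment> \<open>For \<open>j = 2 * k\<close> the weights sum to \<open>14 * (k + 1)\<close>,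
      so the piece with index \<open>k\<close> has degree 0.\<close>
    unfolding gm_torelli_def by (intro torelli_typeI[of k]) (auto simp: sum_gm_weight)
qed

section \<open>Double covers\<close>

text \<open>Turns the equivalence classes of \<open>wproj\<close> into explicit images, so that
  fibres can be computed on representatives.\<close>

definition orbit :: "(nat \<Rightarrow> nat) \<Rightarrow> (nat \<Rightarrow> complex) \<Rightarrow> (nat \<Rightarrow> complex) set" where
  "orbit w a = (\<lambda>t. act w t a) ` {t. t \<noteq> 0}"

lemma act_act: "act w t (act w u a) = act w (t * u) a"
  by (simp add: act_def power_mult_distrib mult.assoc)

lemma act_1 [simp]: "act w 1 a = a"
  by (simp add: act_def)

lemma act_zero_coord: "t \<noteq> 0 \<Longrightarrow> act w t a i = 0 \<longleftrightarrow> a i = 0"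
  by (simp add: act_def)

lemma orbit_self: "a \<in> orbit w a"
  unfolding orbit_def by (rule image_eqI[of _ _ 1]) simp_all

lemma orbit_subset:
  assumes "b \<in> orbit w a" shows "orbit w b \<subseteq> orbit w a"
proof
  fix d assume "d \<in> orbit w b"
  with assms obtain t u where "t \<noteq> 0" "b = act w t a" "u \<noteq> 0" "d = act w u b"
    by (auto simp: orbit_def)
  then have "d = act w (u * t) a" "u * t \<noteq> 0" by (simp_all add: act_act)
  then show "d \<in> orbit w a" unfolding orbit_def by blast
qed

lemma orbit_eq:
  assumes "b \<in> orbit w a" shows "orbit w b = orbit w a"
proof
  obtain t where t: "t \<noteq> 0" "b = act w t a" using assms by (auto simp: orbit_def)
  have "a = act w (1 / t) b" "1 / t \<noteq> 0" using t by (simp_all add: act_act)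
  then have "a \<in> orbit w b" unfolding orbit_def by blast
  then show "orbit w a \<subseteq> orbit w b" by (rule orbit_subset)
qed (rule orbit_subset[OF assms])

lemma affine_space_act:
  assumes "t \<noteq> 0"
  shows "act w t a \<in> affine_space n - {\<lambda>_. 0} \<longleftrightarrow> a \<in> affine_space n - {\<lambda>_. 0}"
proof -
  have "act w t a \<in> affine_space n \<longleftrightarrow> a \<in> affine_space n"
    by (simp add: affine_space_def act_zero_coord[OF assms])
  moreover have "act w t a = (\<lambda>_. 0) \<longleftrightarrow> a = (\<lambda>_. 0)"
    by (simp add: fun_eq_iff act_zero_coord[OF assms])
  ultimately show ?thesis by simp
qed

lemma orbit_iff: "b \<in> orbit w a \<longleftrightarrow> (\<exists>t. t \<noteq> 0 \<and> b = act w t a)"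
  by (auto simp: orbit_def)

lemma wproj_orbit: "wproj n w = orbit w ` (affine_space n - {\<lambda>_. 0})"
proof -
  define A where "A = affine_space n - {\<lambda>_. 0}"
  have act: "act w t a \<in> A" if "t \<noteq> 0" "a \<in> A" for t a
    using affine_space_act[OF that(1), of w a n] that(2) by (simp only: A_def)
  have "{(a, b). a \<in> A \<and> b \<in> A \<and> (\<exists>t. t \<noteq> 0 \<and> b = act w t a)} `` {a} = orbit w a" if "a \<in> A" for a
    using that act by (auto simp: orbit_iff)
  then show ?thesis unfolding wproj_def quotient_def A_def[symmetric] by auto
qed

lemma hypersurface_orbit:
  assumes "f \<in> homogeneous_polys n w (int d)"
  shows "hypersurface n w f = orbit w ` {a \<in> affine_space n - {\<lambda>_. 0}. eval_at a f = 0}"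
proof -
  have "(\<forall>b\<in>orbit w a. eval_at b f = 0) \<longleftrightarrow> eval_at a f = 0" for a
    using orbit_self[of a w] eval_at_act[OF assms] by (auto simp: orbit_def)
  then show ?thesis unfolding hypersurface_def wproj_orbit by auto
qed

lemma forget_coord_orbit: "forget_coord n (orbit w a) = orbit w (a(n := 0))"
proof -
  have "(act w t a)(n := 0) = act w t (a(n := 0))" for t
    by (auto simp: act_def)
  then show ?thesis unfolding forget_coord_def orbit_def image_image by (rule image_cong[OF refl])
qed

text \<open>The acting group is commutative, so all points of an orbit have the same
  stabiliser.\<close>

lemma isotropy_orbit: "isotropy w (orbit w a) = {t. t \<noteq> 0 \<and> act w t a = a}"
proof -
  have "act w t b = b" if t: "act w t a = a" and b: "b \<in> orbit w a" for t b
  proof -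
    obtain u where "b = act w u a" using b by (auto simp: orbit_def)
    then show ?thesis using t by (metis act_act mult.commute)
  qed
  then show ?thesis using orbit_self[of a w] by (auto simp: isotropy_def)
qed

text \<open>Over the orbit of \<open>b\<close> lie the orbits of \<open>b(n := y)\<close> with
  \<open>y^2 = - eval_at b g\<close>. The condition \<open>d = 2 * w n\<close> makes the equation
  homogeneous.\<close>

lemma double_cover_square:
  assumes g: "g \<in> homogeneous_polys n w (int d)" and d: "d = 2 * w n" "d > 0"
  shows "double_cover_branched_over n w (g + (var n)\<^sup>2) g"
proof -
  let ?f = "g + (var n)\<^sup>2"
  have f: "?f \<in> homogeneous_polys (Suc n) w (int d)"
  proof (rule homogeneous_polys_add)
    show "g \<in> homogeneous_polys (Suc n) w (int d)"
      using g by (fastforce simp: homogeneous_polys_def polys_def)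
    show "(var n)\<^sup>2 \<in> homogeneous_polys (Suc n) w (int d)"
      by (rule homogeneous_polys_power[OF homogeneous_polys_var]) (simp_all add: d)
  qed
  have g_polys: "g \<in> polys n" using g by (simp add: homogeneous_polys_def)
  have eval_f: "eval_at (b(n := y)) ?f = eval_at b g + y^2" for b y
    by (simp add: eval_at_affine_space_extend[OF g_polys])
  \<comment> \<open>Positive degree makes \<open>g\<close> vanish at the origin. This keeps the
    centre of projection, where only coordinate \<open>n\<close> is nonzero, off the
    hypersurface.\<close>
  have eval_0: "eval_at (\<lambda>_. 0) g = 0"
  proof -
    have "act w 0 (\<lambda>_. 0) = (\<lambda>_. 0)" by (simp add: act_def)
    then show ?thesis using eval_at_act[OF g, of 0 "\<lambda>_. 0"] d(2) by (simp add: zero_power)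
  qed
  let ?r = "\<lambda>b. csqrt (- eval_at b g)"
  have root: "y^2 = - eval_at b g \<longleftrightarrow> y = ?r b \<or> y = - ?r b" for b y
    using power2_eq_iff[of y "?r b"] by simp
  have lift: "orbit w (b(n := y)) \<in> hypersurface (Suc n) w ?f" "forget_coord n (orbit w (b(n := y))) = orbit w b"
    if b: "b \<in> affine_space n - {\<lambda>_. 0}" and y: "y^2 = - eval_at b g" for b y
  proof -
    obtain l where l: "b l \<noteq> 0" using b by auto
    then have "l < n" using b by (auto simp: affine_space_def not_less[symmetric])
    then have "(b(n := y)) l \<noteq> 0" using l by simp
    then have "b(n := y) \<noteq> (\<lambda>_. 0)" by metis
    moreover have "b(n := y) \<in> affine_space (Suc n)" using b by (auto simp: affine_space_def)
    moreover have "eval_at (b(n := y)) ?f = 0" unfolding eval_f using y by simp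
    ultimately show "orbit w (b(n := y)) \<in> hypersurface (Suc n) w ?f"
      unfolding hypersurface_orbit[OF f] by blast
    have "(b(n := y))(n := 0) = b" using b by (auto simp: affine_space_def)
    then show "forget_coord n (orbit w (b(n := y))) = orbit w b" by (simp add: forget_coord_orbit)
  qed
  have project: "a(n := 0) \<in> affine_space n - {\<lambda>_. 0}"
    if "a \<in> affine_space (Suc n) - {\<lambda>_. 0}" "eval_at a ?f = 0" for a
  proof -
    have "a(n := 0) \<noteq> (\<lambda>_. 0)"
    proof
      assume z: "a(n := 0) = (\<lambda>_. 0)"
      have "eval_at (a(n := 0)) g + (a n)^2 = 0"
        using eval_f[of "a(n := 0)" "a n"] that(2) by simp
      then have "a n = 0" unfolding z eval_0 by simp
      then have "a = (\<lambda>_. 0)" using z by (metis fun_upd_triv)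
      with that(1) show False by simp
    qed
    moreover have "a(n := 0) \<in> affine_space n"
      using that(1) by (auto simp: affine_space_def Suc_le_eq)
    ultimately show ?thesis by blast
  qed
  have fibre: "{P \<in> hypersurface (Suc n) w ?f. forget_coord n P = orbit w b}
      = {orbit w (b(n := ?r b)), orbit w (b(n := - ?r b))}"
    if b: "b \<in> affine_space n - {\<lambda>_. 0}" for b
  proof
    show "{orbit w (b(n := ?r b)), orbit w (b(n := - ?r b))}
        \<subseteq> {P \<in> hypersurface (Suc n) w ?f. forget_coord n P = orbit w b}"
      using lift[OF b] root by auto
    show "{P \<in> hypersurface (Suc n) w ?f. forget_coord n P = orbit w b}
        \<subseteq> {orbit w (b(n := ?r b)), orbit w (b(n := - ?r b))}"
    proof
      fix P assume "P \<in> {P \<in> hypersurface (Suc n) w ?f. forget_coord n P = orbit w b}"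
      then have P: "P \<in> hypersurface (Suc n) w ?f" "forget_coord n P = orbit w b" by simp_all
      obtain a where a: "P = orbit w a" "eval_at a ?f = 0"
        using P(1) unfolding hypersurface_orbit[OF f] by blast
      have "b \<in> orbit w (a(n := 0))"
        using P(2) orbit_self[of b w] unfolding a(1) forget_coord_orbit by simp
      then obtain t where t: "t \<noteq> 0" "b = act w t (a(n := 0))" by (auto simp: orbit_def)
      \<comment> \<open>Rescaling the representative by \<open>t\<close> makes its first
        \<open>n\<close> coordinates equal to those of \<open>b\<close>; the last one is then a
        square root of \<open>- eval_at b g\<close>.\<close>
      let ?y = "act w t a n"
      have a': "act w t a = b(n := ?y)" using t(2) by (auto simp: act_def)
      have "eval_at (b(n := ?y)) ?f = 0"
        unfolding a'[symmetric] eval_at_act[OF f] using a(2) by simp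
      then have "?y^2 = - eval_at b g" unfolding eval_f by (simp add: add_eq_0_iff)
      moreover have "P = orbit w (b(n := ?y))"
        unfolding a'[symmetric] a(1) by (rule orbit_eq[symmetric]) (use t in \<open>auto simp: orbit_def\<close>)
      ultimately show "P \<in> {orbit w (b(n := ?r b)), orbit w (b(n := - ?r b))}"
        using root[of ?y b] by auto
    qed
  qed
  show ?thesis
    unfolding double_cover_branched_over_def
  proof (intro conjI ballI)
    show "forget_coord n ` hypersurface (Suc n) w ?f = wproj n w"
    proof
      show "forget_coord n ` hypersurface (Suc n) w ?f \<subseteq> wproj n w"
        unfolding hypersurface_orbit[OF f] wproj_orbit
        using project by (auto simp: forget_coord_orbit)
      show "wproj n w \<subseteq> forget_coord n ` hypersurface (Suc n) w ?f"
      proof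
        fix Q assume "Q \<in> wproj n w"
        then obtain b where b: "b \<in> affine_space n - {\<lambda>_. 0}" "Q = orbit w b"
          unfolding wproj_orbit by blast
        have "(?r b)^2 = - eval_at b g" by simp
        from lift[OF b(1) this] b(2) show "Q \<in> forget_coord n ` hypersurface (Suc n) w ?f" by (metis imageI)
      qed
    qed
    fix Q assume "Q \<in> wproj n w"
    then obtain b where b: "b \<in> affine_space n - {\<lambda>_. 0}" "Q = orbit w b"
      unfolding wproj_orbit by blast
    let ?P = "orbit w (b(n := ?r b))" and ?P' = "orbit w (b(n := - ?r b))"
    have card: "card {?P, ?P'} = (if ?P = ?P' then 1 else 2)" by simp
    have branch: "?P = ?P'" if "Q \<in> hypersurface n w g"
    proof -
      have "eval_at b g = 0" using that orbit_self[of b w] by (auto simp: hypersurface_def b(2))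
      then show ?thesis by simp
    qed
    have unramified: "?P \<noteq> ?P'" if "Q \<notin> hypersurface n w g" "isotropy w Q = {1}"
    proof
      assume "?P = ?P'"
      then have "b(n := - ?r b) \<in> orbit w (b(n := ?r b))" using orbit_self by metis
      then obtain t where t: "t \<noteq> 0" "b(n := - ?r b) = act w t (b(n := ?r b))" by (auto simp: orbit_def)
      \<comment> \<open>A scalar carrying one lift to the other fixes \<open>b\<close>, so it lies
        in the isotropy group. At index \<open>n\<close> both sides are 0, as \<open>b\<close> is
        extended by zero.\<close>
      have "b i = t ^ w i * b i" for i
      proof (cases "i = n")
        case False
        then show ?thesis using fun_cong[OF t(2), of i] by (simp add: act_def)
      qed (use b(1) in \<open>simp add: affine_space_def\<close>)
      then have "act w t b = b" unfolding act_def by (intro ext) (rule sym)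
      then have "t = 1" using t(1) that(2) unfolding b(2) isotropy_orbit by blast
      then have "- ?r b = ?r b" using fun_cong[OF t(2), of n] by (simp add: act_def)
      then have "?r b = 0" by (simp add: complex_eq_iff del: csqrt.simps)
      then have "eval_at b g = 0" by simp
      then have "Q \<in> hypersurface n w g" unfolding hypersurface_orbit[OF g] using b by blast
      with that(1) show False by simp
    qed
    show "let fibre = {P \<in> hypersurface (Suc n) w ?f. forget_coord n P = Q} in
          card fibre \<in> {1, 2} \<and> (Q \<in> hypersurface n w g \<longrightarrow> card fibre = 1) \<and>
          (Q \<notin> hypersurface n w g \<and> isotropy w Q = {1} \<longrightarrow> card fibre = 2)"
      unfolding Let_def b(2) fibre[OF b(1)] card
      using branch unramified unfolding b(2) by simp
  qed
qed

section \<open>A tower of quasi-smooth members\<close>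

text \<open>One monomial of degree 14 for each coordinate point, namely \<open>x^7\<close>,
  \<open>x * z^3\<close>, \<open>y^3 * w\<close> and \<open>z * w^2\<close>.\<close>

definition tower_base :: cpoly where
  "tower_base = var 0 ^ 7 + var 0 * var 2 ^ 3 + var 1 ^ 3 * var 3 + var 2 * var 3 ^ 2"

lemma gm_tower_Suc: "gm_tower f0 (Suc j) = gm_tower f0 j + (var (4 + j))\<^sup>2"
  by (simp add: gm_tower_def add.assoc)

lemma gm_tower_homogeneous: "gm_tower tower_base j \<in> homogeneous_polys (4 + j) gm_weight (int 14)"
proof -
  let ?H = "homogeneous_polys (4 + j) gm_weight"
  have v: "var 0 \<in> ?H 2" "var 1 \<in> ?H 3" "var 2 \<in> ?H 4" "var 3 \<in> ?H 5"
    using homogeneous_polys_var[of 0 "4 + j" gm_weight] homogeneous_polys_var[of 1 "4 + j" gm_weight]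
      homogeneous_polys_var[of 2 "4 + j" gm_weight] homogeneous_polys_var[of 3 "4 + j" gm_weight]
    by simp_all
  have "var 0 ^ 7 \<in> ?H 14" "var 2 ^ 3 \<in> ?H 12" "var 1 ^ 3 \<in> ?H 9" "var 3 ^ 2 \<in> ?H 10"
    using homogeneous_polys_power[OF v(1), of 7] homogeneous_polys_power[OF v(3), of 3]
      homogeneous_polys_power[OF v(2), of 3] homogeneous_polys_power[OF v(4), of 2] by simp_all
  then have "tower_base \<in> ?H (int 14)"
    unfolding tower_base_def
    using homogeneous_polys_mult[OF v(1), of "var 2 ^ 3" 12 14]
      homogeneous_polys_mult[OF _ v(4), of "var 1 ^ 3" 9 14]
      homogeneous_polys_mult[OF v(3), of "var 3 ^ 2" 10 14]
    by (intro homogeneous_polys_add) simp_all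
  moreover have "(var (4 + i))\<^sup>2 \<in> ?H (int 14)" if "i < j" for i
    by (rule homogeneous_polys_power[OF homogeneous_polys_var]) (use that in simp_all)
  ultimately show ?thesis
    unfolding gm_tower_def by (intro homogeneous_polys_add homogeneous_polys_sum) auto
qed

text \<open>The gradient equations force the coordinates to vanish in the order \<open>y\<close>,
  \<open>w\<close>, then \<open>x\<close> and \<open>z\<close> together; each square forces its own
  variable to vanish.\<close>

lemma gm_tower_quasi_smooth: "quasi_smooth (4 + j) (gm_tower tower_base j)"
  unfolding quasi_smooth_def
proof (intro ballI impI, rule ccontr)
  fix a assume a: "a \<in> affine_space (4 + j) - {\<lambda>_. 0}"
    and "\<not> (\<exists>i<4 + j. eval_at a (partial i (gm_tower tower_base j)) \<noteq> 0)"
  then have crit: "eval_at a (partial i (gm_tower tower_base j)) = 0" if "i < 4 + j" for i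
    using that by blast
  have e: "7 * a 0 ^ 6 + a 2 ^ 3 = 0" "a 1 ^ 2 * a 3 = 0" "3 * a 0 * a 2 ^ 2 + a 3 ^ 2 = 0"
    "a 1 ^ 3 + 2 * a 2 * a 3 = 0"
    using crit[of 0] crit[of 1] crit[of 2] crit[of 3]
    by (simp_all add: gm_tower_def tower_base_def algebra_simps)
  have "a 1 = 0"
  proof (rule ccontr)
    assume "a 1 \<noteq> 0"
    with e(2) have "a 3 = 0" by simp
    with e(4) \<open>a 1 \<noteq> 0\<close> show False by simp
  qed
  moreover have "a 3 = 0"
  proof (rule ccontr)
    assume "a 3 \<noteq> 0"
    with e(4) \<open>a 1 = 0\<close> have "a 2 = 0" by simp
    with e(3) \<open>a 3 \<noteq> 0\<close> show False by simp
  qed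
  moreover have "a 0 = 0 \<and> a 2 = 0" using e(1,3) \<open>a 3 = 0\<close> by auto
  moreover have "a (4 + l) = 0" if "l < j" for l
  proof -
    have "(\<Sum>i<j. eval_at a (partial (4 + l) ((var (4 + i))\<^sup>2))) = 2 * a (4 + l)"
      using sum_single_index[OF that, of "\<lambda>i. eval_at a (partial (4 + l) ((var (4 + i))\<^sup>2))"] by simp
    then show ?thesis
      using crit[of "4 + l"] that by (simp add: gm_tower_def tower_base_def)
  qed
  ultimately have "a i = 0" for i
  proof -
    consider "i = 0" | "i = 1" | "i = 2" | "i = 3" | "4 \<le> i" "i < 4 + j" | "i \<ge> 4 + j" by linarith
    then show ?thesis
    proof cases
      case 5
      then have "i = 4 + (i - 4)" "i - 4 < j" by simp_all
      then show ?thesis using \<open>\<And>l. l < j \<Longrightarrow> a (4 + l) = 0\<close> by metis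
    qed (use a \<open>a 1 = 0\<close> \<open>a 3 = 0\<close> \<open>a 0 = 0 \<and> a 2 = 0\<close> in \<open>auto simp: affine_space_def\<close>)
  qed
  with a show False by auto
qed

lemma gm_member_tower: "gm_member j (gm_tower tower_base j)"
  using gm_tower_homogeneous[of j] gm_tower_quasi_smooth[of j] by (simp add: gm_member_def)

lemma double_cover_tower:
  "double_cover_branched_over (4 + j) gm_weight (gm_tower tower_base (Suc j)) (gm_tower tower_base j)"
  unfolding gm_tower_Suc by (rule double_cover_square[OF gm_tower_homogeneous]) simp_all

theorem mainTheorem4:
  shows "(\<forall>k f. gm_member (2 * k + 1) f \<longrightarrow> gm_anti_torelli (2 * k + 1) f) \<and>
         (\<forall>k f. gm_member (2 * k) f \<longrightarrow> gm_torelli (2 * k) f) \<and>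
         (\<exists>f0. gm_member 0 f0 \<and>
            (\<forall>j. gm_member j (gm_tower f0 j) \<and>
                 double_cover_branched_over (4 + j) gm_weight
                   (gm_tower f0 (Suc j)) (gm_tower f0 j) \<and>
                 (even (j + 2) \<longrightarrow> gm_torelli j (gm_tower f0 j)) \<and>
                 (odd (j + 2) \<longrightarrow> gm_anti_torelli j (gm_tower f0 j))))"
proof (intro conjI allI impI exI[of _ tower_base])
  show "gm_member 0 tower_base" using gm_member_tower[of 0] by (simp add: gm_tower_def)
qed (simp_all add: gm_member_tower double_cover_tower gm_torelli_even gm_anti_torelli_odd)

end
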